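(* Let $(B,+,\cdot)$ be a skew brace such that $(B,+)$ is a $\mathrm{CCS}$ group, with $|B| = p^{\alpha}p_2^{\alpha_2}\cdots p_t^{\alpha_t} = p^\alpha m$, where $2<p<p_2<\cdots<p_t$ are primes, $\alpha$ is a positive integer, $\alpha_2,\dots,\alpha_t$ are non-negative integers, and $m=p_2^{\alpha_2}\cdots p_t^{\alpha_t}$. Suppose that $(B,+)$ is non-nilpotent and non-perfect. Then one of the following holds. (1) The group $(B,\cdot)$ is nilpotent, and $(B,\cdot) \cong C_m \times Q$, where $Q$ is a $p$-group having a maximal subgroup that is cyclic. (2) The group $(B,\cdot)$ is non-nilpotent, and $(B,\cdot) \cong K \rtimes Q$, where $K$ is a $\mathrm{Z}$-group of order $m$, and $Q$ is a $p$-group having a maximal subgroup that is cyclic.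
   Context: A skew brace (skew left brace) is a triple $(B,+,\cdot)$ such that $(B,+)$ and $(B,\cdot)$ are groups (neither assumed abelian) and $a\cdot(b+c)=a\cdot b-a+a\cdot c$ for all $a,b,c\in B$, where $-a$ is the inverse of $a$ in $(B,+)$. A group is characteristically simple if it has no characteristic subgroups other than the trivial subgroup and itself. A $\mathrm{CCS}$ group is a finite group $G$ that is non-cyclic, not characteristically simple, and such that every proper characteristic subgroup of $G$ is cyclic. A $\mathrm{Z}$-group is a finite group all of whose Sylow subgroups are cyclic. $C_m$ denotes the cyclic group of order $m$. *)

theory Defs
  imports "HOL-Algebra.Algebra" "HOL-Algebra.Bij" "HOL-Computational_Algebra.Primes"
begin

text \<open>
  The record type for rings serves here only as a signature with two operations on one carrier:
  the additive group of a skew brace \<open>B\<close> is \<open>add_monoid B\<close>, and the multiplicative group is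
  \<open>B\<close> itself, viewed as a monoid record. No ring or commutativity axioms are imposed.
\<close>

locale skew_brace =
  fixes B (structure)
  assumes additive_group: "group (add_monoid B)"
    and multiplicative_group: "group B"
    and brace_distrib:
      "\<lbrakk>a \<in> carrier B; b \<in> carrier B; c \<in> carrier B\<rbrakk>
        \<Longrightarrow> a \<otimes> (b \<oplus> c) = (a \<otimes> b \<ominus> a) \<oplus> (a \<otimes> c)"

definition characteristic_subgroup :: "'a set \<Rightarrow> ('a, 'b) monoid_scheme \<Rightarrow> bool"
  where "characteristic_subgroup H G \<longleftrightarrow> subgroup H G \<and> (\<forall>f \<in> iso G G. f ` H = H)"

definition characteristically_simple :: "('a, 'b) monoid_scheme \<Rightarrow> bool"
  where "characteristically_simple G \<longleftrightarrow>
    (\<forall>H. characteristic_subgroup H G \<longrightarrow> H = {\<one>\<^bsub>G\<^esub>} \<or> H = carrier G)"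

definition CCS_group :: "('a, 'b) monoid_scheme \<Rightarrow> bool"
  where "CCS_group G \<longleftrightarrow>
    group G \<and> finite (carrier G) \<and> \<not> cyclic_group G \<and> \<not> characteristically_simple G \<and>
    (\<forall>H. characteristic_subgroup H G \<and> H \<noteq> carrier G \<longrightarrow> cyclic_group (G\<lparr>carrier := H\<rparr>))"

primrec lower_central_series :: "('a, 'b) monoid_scheme \<Rightarrow> nat \<Rightarrow> 'a set"
  where
    "lower_central_series G 0 = carrier G"
  | "lower_central_series G (Suc n) =
      generate G (\<Union>h \<in> lower_central_series G n. \<Union>g \<in> carrier G.
        {h \<otimes>\<^bsub>G\<^esub> g \<otimes>\<^bsub>G\<^esub> inv\<^bsub>G\<^esub> h \<otimes>\<^bsub>G\<^esub> inv\<^bsub>G\<^esub> g})"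

definition nilpotent_group :: "('a, 'b) monoid_scheme \<Rightarrow> bool"
  where "nilpotent_group G \<longleftrightarrow> group G \<and> (\<exists>n. lower_central_series G n = {\<one>\<^bsub>G\<^esub>})"

definition perfect_group :: "('a, 'b) monoid_scheme \<Rightarrow> bool"
  where "perfect_group G \<longleftrightarrow> group G \<and> derived G (carrier G) = carrier G"

definition sylow_subgroup :: "nat \<Rightarrow> 'a set \<Rightarrow> ('a, 'b) monoid_scheme \<Rightarrow> bool"
  where "sylow_subgroup r P G \<longleftrightarrow>
    subgroup P G \<and> card P = r ^ multiplicity r (Coset.order G)"

definition Z_group :: "('a, 'b) monoid_scheme \<Rightarrow> bool"
  where "Z_group G \<longleftrightarrow> group G \<and> finite (carrier G) \<and>
    (\<forall>r P. Factorial_Ring.prime r \<and> sylow_subgroup r P G \<longrightarrow> cyclic_group (G\<lparr>carrier := P\<rparr>))"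

text \<open>Finiteness is implied below, since \<open>Coset.order\<close> is \<open>0\<close> on infinite carriers.\<close>

definition p_group :: "nat \<Rightarrow> ('a, 'b) monoid_scheme \<Rightarrow> bool"
  where "p_group p G \<longleftrightarrow> group G \<and> Factorial_Ring.prime p \<and> (\<exists>k. Coset.order G = p ^ k)"

definition maximal_subgroup :: "'a set \<Rightarrow> ('a, 'b) monoid_scheme \<Rightarrow> bool"
  where "maximal_subgroup M G \<longleftrightarrow> subgroup M G \<and> M \<noteq> carrier G \<and>
    (\<forall>H. subgroup H G \<and> M \<subseteq> H \<longrightarrow> H = M \<or> H = carrier G)"

definition has_cyclic_maximal_subgroup :: "('a, 'b) monoid_scheme \<Rightarrow> bool"
  where "has_cyclic_maximal_subgroup G \<longleftrightarrow>
    (\<exists>M. maximal_subgroup M G \<and> cyclic_group (G\<lparr>carrier := M\<rparr>))"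

text \<open>
  External semidirect product of \<open>K\<close> (the normal factor) and \<open>Q\<close> for an action
  \<open>\<phi> \<in> hom Q (AutoGroup K)\<close>.
\<close>

definition semidirect_product ::
  "('a, 'c) monoid_scheme \<Rightarrow> ('b \<Rightarrow> 'a \<Rightarrow> 'a) \<Rightarrow> ('b, 'd) monoid_scheme \<Rightarrow> ('a \<times> 'b) monoid"
  where "semidirect_product K \<phi> Q =
    \<lparr>carrier = carrier K \<times> carrier Q,
     monoid.mult = (\<lambda>(k, q) (k', q'). (k \<otimes>\<^bsub>K\<^esub> \<phi> q k', q \<otimes>\<^bsub>Q\<^esub> q')),
     one = (\<one>\<^bsub>K\<^esub>, \<one>\<^bsub>Q\<^esub>)\<rparr>"

lemma group_semidirect_product:
  assumes K: "group K" and Q: "group Q" and \<phi>: "\<phi> \<in> hom Q (AutoGroup K)"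
  shows "group (semidirect_product K \<phi> Q)"
proof -
  interpret K: group K by fact
  interpret Q: group Q by fact
  interpret \<phi>: group_hom Q "AutoGroup K" \<phi>
    using K.AutoGroup Q \<phi> by (simp add: group_hom_def group_hom_axioms_def)
  have aut: "\<phi> q \<in> hom K K" "\<phi> q \<in> Bij (carrier K)" if "q \<in> carrier Q" for q
    using \<phi>.hom_closed[OF that] by (auto simp: AutoGroup_def auto_def)
  have closed: "\<phi> q k \<in> carrier K" if "q \<in> carrier Q" "k \<in> carrier K" for q k
    using aut(1)[OF that(1)] that(2) by (auto simp: hom_def)
  have mult: "\<phi> q (k \<otimes>\<^bsub>K\<^esub> k') = \<phi> q k \<otimes>\<^bsub>K\<^esub> \<phi> q k'"
    if "q \<in> carrier Q" "k \<in> carrier K" "k' \<in> carrier K" for q k k'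
    using aut(1)[OF that(1)] that by (auto simp: hom_def)
  have comp: "\<phi> (q \<otimes>\<^bsub>Q\<^esub> q') k = \<phi> q (\<phi> q' k)"
    if "q \<in> carrier Q" "q' \<in> carrier Q" "k \<in> carrier K" for q q' k
    using \<phi>.hom_mult[OF that(1,2)] aut(2)[OF that(1)] aut(2)[OF that(2)] that(3)
    by (simp add: AutoGroup_def BijGroup_def compose_def)
  have one: "\<phi> \<one>\<^bsub>Q\<^esub> k = k" if "k \<in> carrier K" for k
    using \<phi>.hom_one that by (simp add: AutoGroup_def BijGroup_def)
  show ?thesis
  proof (rule groupI)
    fix x assume "x \<in> carrier (semidirect_product K \<phi> Q)"
    then obtain k q where x: "x = (k, q)" "k \<in> carrier K" "q \<in> carrier Q"
      by (auto simp: semidirect_product_def)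
    let ?y = "(\<phi> (inv\<^bsub>Q\<^esub> q) (inv\<^bsub>K\<^esub> k), inv\<^bsub>Q\<^esub> q)"
    have "\<phi> (inv\<^bsub>Q\<^esub> q) (inv\<^bsub>K\<^esub> k) \<otimes>\<^bsub>K\<^esub> \<phi> (inv\<^bsub>Q\<^esub> q) k = \<phi> (inv\<^bsub>Q\<^esub> q) \<one>\<^bsub>K\<^esub>"
      using x mult[of "inv\<^bsub>Q\<^esub> q" "inv\<^bsub>K\<^esub> k" k] by simp
    also have "\<dots> = \<one>\<^bsub>K\<^esub>"
      using x aut(1)[of "inv\<^bsub>Q\<^esub> q"] hom_one[OF _ K K] by simp
    finally show "\<exists>y \<in> carrier (semidirect_product K \<phi> Q).
        y \<otimes>\<^bsub>semidirect_product K \<phi> Q\<^esub> x = \<one>\<^bsub>semidirect_product K \<phi> Q\<^esub>"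
      using x closed by (intro bexI[of _ ?y]) (auto simp: semidirect_product_def simp del: \<phi>.hom_inv)
  qed (auto simp: semidirect_product_def closed mult comp one K.m_assoc Q.m_assoc
        simp del: \<phi>.hom_mult \<phi>.hom_one)
qed

end

theory Submission
  imports Defs "HOL-Number_Theory.Pocklington"
begin

text \<open>
  Write \<open>G\<close> for the additive group and \<open>C\<close> for the centralizer of its derived subgroup. Both
  subgroups are characteristic and proper, hence cyclic, and every characteristic subgroup strictly
  between \<open>C\<close> and \<open>G\<close> would be cyclic and so contained in \<open>C\<close>. Therefore \<open>G Mod C\<close> has prime
  exponent \<open>r\<close>; as \<open>G\<close> is not nilpotent, it acts faithfully on a subgroup of \<open>C\<close> of prime order, so
  it has order \<open>r\<close>, and \<open>r\<close> must be the least prime divisor \<open>p\<close> of the order of \<open>G\<close>.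

  All subgroups of the cyclic group \<open>C\<close> are characteristic in \<open>G\<close>, hence invariant under the
  \<open>lambda\<close>-action, hence also subgroups of the multiplicative group. Those of odd prime power order
  are cyclic for the multiplication too. The subgroup \<open>A\<close> of order \<open>m\<close> acts trivially on \<open>G Mod A\<close>,
  since all prime divisors of \<open>m\<close> exceed \<open>p\<close>; this makes \<open>A\<close> normal in the multiplicative group,
  which therefore splits over \<open>A\<close> with a Sylow \<open>p\<close>-subgroup as complement.
\<close>

section \<open>Congruences modulo prime powers\<close>

text \<open>The action \<open>lam\<close> controls only additive subgroups that are characteristic;
  by itself it makes no multiplicative subgroup normal or cyclic. Normality of \<open>A\<close>
  comes from comparing cosets: if \<open>lam a x\<close> lies in \<open>A + x\<close> for every
  \<open>a\<close> in \<open>A\<close>, then the multiplicative coset of \<open>A\<close> through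
  \<open>x\<close> lies in \<open>A + x\<close>, and equals it by counting. On the other side the
  multiplicative left coset of \<open>x\<close> is \<open>x + lam x A = x + A\<close>, because
  \<open>A\<close> is characteristic.

  Cyclicity is where odd primes matter. A multiplicative power of \<open>g\<close> is an additive
  multiple of \<open>g\<close> by a geometric sum \<open>1 + u + ... + u ^ (p ^ j - 1)\<close>. For
  odd \<open>p\<close> and \<open>u = 1\<close> modulo \<open>p\<close> this sum is not divisible by
  \<open>p ^ Suc j\<close>, whereas \<open>1 + 3 = 4\<close> already fails at 2.

  That the index of \<open>C\<close> is the least prime \<open>p\<close> serves twice. The
  automorphism groups of a cyclic \<open>p\<close>-group and of a group of order \<open>p\<close>
  involve only primes up to \<open>p\<close>, so an action of period \<open>m\<close> is trivial
  there. And the \<open>p\<close>-part of \<open>C\<close> is only one factor \<open>p\<close>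
  smaller than a Sylow \<open>p\<close>-subgroup; this is the source of the cyclic maximal subgroup
  of \<open>Q\<close>.\<close>

lemma cong_1_if_pow_cong_1:
  fixes u :: nat
  assumes p: "Factorial_Ring.prime p"
    and m: "\<And>l. Factorial_Ring.prime l \<Longrightarrow> l dvd m \<Longrightarrow> p < l"
    and u: "[u ^ m = 1] (mod p ^ k)"
  shows "[u = 1] (mod p ^ k)"
proof (cases "k = 0")
  case False
  \<comment> \<open>Zero is divisible by 2, so \<open>m = 0\<close> would give
    \<open>p < 2\<close>.\<close>
  have "m \<noteq> 0"
    using m[of 2] prime_ge_2_nat[OF p] by (cases m) auto
  have "coprime u (p ^ k)"
    using cong_imp_coprime[OF cong_sym[OF u]] \<open>m \<noteq> 0\<close> by simp
  then have "[u ^ totient (p ^ k) = 1] (mod p ^ k)"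
    by (rule euler_theorem)
  \<comment> \<open>Prime factors of \<open>totient (p ^ k)\<close> divide \<open>p\<close> or
    \<open>p - 1\<close>, hence are at most \<open>p\<close>, while those of \<open>m\<close> exceed
    \<open>p\<close>. The order of \<open>u\<close> divides both numbers, so it is 1.\<close>
  moreover have "coprime m (totient (p ^ k))"
  proof (rule ccontr)
    assume "\<not> ?thesis"
    then have "gcd m (totient (p ^ k)) \<noteq> 1"
      by (simp only: coprime_iff_gcd_eq_1 not_False_eq_True)
    then obtain l where l: "Factorial_Ring.prime l" "l dvd m" "l dvd totient (p ^ k)"
      using prime_factor_nat by (metis gcd_greatest_iff)
    from l(3) have "l dvd p ^ (k - 1) * (p - 1)"
      using False p by (simp add: totient_prime_power)
    then have "l dvd p \<or> l dvd p - 1"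
      using l(1) prime_dvd_mult_nat prime_dvd_power by blast
    then have "l \<le> p"
      using prime_gt_1_nat[OF p] by (auto dest!: dvd_imp_le)
    with m[OF l(1,2)] show False by simp
  qed
  ultimately have "Pocklington.ord (p ^ k) u dvd 1"
    using u unfolding ord_divides by (metis coprime_common_divisor)
  then show ?thesis
    using ord_divides[of u 1] by simp
qed simp

text \<open>Cut the range into \<open>b\<close> blocks of length \<open>a\<close>; with
  \<open>a = p ^ j\<close> and \<open>b = p\<close> this drives the induction on \<open>j\<close>
  below.\<close>

lemma geometric_sum_mult:
  fixes u :: "'a :: comm_semiring_1"
  shows "(\<Sum>i<a * b. u ^ i) = (\<Sum>i<a. u ^ i) * (\<Sum>i<b. (u ^ a) ^ i)"
proof (induction b)
  case (Suc b)
  have "(\<Sum>i<a * Suc b. u ^ i) = (\<Sum>i<a * b. u ^ i) + (\<Sum>i<a. u ^ (a * b + i))"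
    using sum.nat_group[of "\<lambda>i. u ^ i" a "Suc b"] sum.nat_group[of "\<lambda>i. u ^ i" a b]
      sum.shift_bounds_nat_ivl[of "\<lambda>i. u ^ i" 0 "a * b" a]
    by (simp add: atLeast0LessThan mult.commute add.commute)
  also have "(\<Sum>i<a. u ^ (a * b + i)) = (\<Sum>i<a. u ^ i) * (u ^ a) ^ b"
    by (simp add: power_add power_mult sum_distrib_right mult.commute)
  finally show ?case
    using Suc by (simp add: algebra_simps)
qed simp

text \<open>Modulo \<open>p ^ 2\<close>, \<open>w = 1 + p * c\<close> gives
  \<open>w ^ i = 1 + p * c * i\<close>, so the sum is \<open>p\<close> plus \<open>p * c\<close>
  times a triangular number. Oddness of \<open>p\<close> makes that number a multiple of
  \<open>p\<close>.\<close>

lemma geometric_sum_cong_prime_square: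
  fixes w :: nat
  assumes p: "Factorial_Ring.prime p" "2 < p" and w: "[w = 1] (mod p)"
  shows "[(\<Sum>i<p. w ^ i) = p] (mod p ^ 2)"
proof -
  obtain c where c: "[w = 1 + p * c] (mod p ^ 2)"
  proof (cases "w = 0")
    case True
    then show ?thesis
      using w p by (auto simp: cong_def)
  next
    case False
    then have "p dvd w - 1"
      using w by (intro cong_to_1_nat) simp
    then obtain d where "w - 1 = p * d" by auto
    then have "w = 1 + p * d" using False by simp
    with that[of d] show ?thesis by (simp del: One_nat_def)
  qed
  have pow: "[w ^ i = 1 + p * (c * i)] (mod p ^ 2)" for i
  proof (induction i)
    case (Suc i)
    have "[w ^ Suc i = (1 + p * c) * (1 + p * (c * i))] (mod p ^ 2)"
      using cong_mult[OF c Suc] by simp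
    also have "(1 + p * c) * (1 + p * (c * i)) = 1 + p * (c * Suc i) + p ^ 2 * (c * c * i)"
      by (simp add: algebra_simps power2_eq_square)
    also have "[\<dots> = 1 + p * (c * Suc i)] (mod p ^ 2)"
      by (simp add: cong_def)
    finally show ?case .
  qed simp
  have "odd p" using p prime_odd_nat by auto
  then obtain h where h: "p = 2 * h + 1" by (elim oddE)
  have "2 * (\<Sum>i<p. i) = p * (2 * h)"
    using Sum_Ico_nat[of 0 p] h by (simp add: atLeast0LessThan)
  then have tri: "(\<Sum>i<p. i) = p * h" by simp
  have "[(\<Sum>i<p. w ^ i) = (\<Sum>i<p. 1 + p * (c * i))] (mod p ^ 2)"
    by (rule cong_sum) (rule pow)
  also have "(\<Sum>i<p. 1 + p * (c * i)) = p + p * c * (\<Sum>i<p. i)"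
    by (simp only: sum.distrib sum_distrib_left mult.assoc) simp
  also have "\<dots> = p + p ^ 2 * (c * h)"
    by (simp only: tri) (simp add: power2_eq_square)
  also have "[\<dots> = p] (mod p ^ 2)"
    by (simp add: cong_def)
  finally show ?thesis .
qed

text \<open>Passing from \<open>j\<close> to \<open>Suc j\<close> multiplies the sum by a factor
  that is \<open>p\<close> modulo \<open>p ^ 2\<close>, that is, \<open>p\<close> times something
  prime to \<open>p\<close>. So the power of \<open>p\<close> grows by exactly one.\<close>

lemma not_dvd_geometric_sum:
  fixes u :: nat
  assumes p: "Factorial_Ring.prime p" "2 < p" and u: "[u = 1] (mod p)"
  shows "\<not> p ^ Suc j dvd (\<Sum>i<p ^ j. u ^ i)"
proof (induction j)
  case 0
  then show ?case using p by simp
next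
  case (Suc j)
  let ?T = "\<Sum>i<p. (u ^ (p ^ j)) ^ i"
  have "[?T = p] (mod p ^ 2)"
    using geometric_sum_cong_prime_square[OF p, of "u ^ (p ^ j)"] cong_pow[OF u, of "p ^ j"] by simp
  then have T: "?T mod p ^ 2 = p"
    using p by (simp add: cong_def power2_eq_square)
  obtain t where t: "?T = p * (1 + p * t)"
  proof
    have "?T = p ^ 2 * (?T div p ^ 2) + ?T mod p ^ 2" by (rule mult_div_mod_eq[symmetric])
    also have "\<dots> = p * (1 + p * (?T div p ^ 2))"
      unfolding T by (simp only: power2_eq_square distrib_left mult_1_right mult.assoc add.commute)
    finally show "?T = p * (1 + p * (?T div p ^ 2))" .
  qed
  have sum: "(\<Sum>i<p ^ Suc j. u ^ i) = (\<Sum>i<p ^ j. u ^ i) * ?T"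
    using geometric_sum_mult[of u "p ^ j" p] by (simp add: mult.commute)
  show ?case
  proof
    assume "p ^ Suc (Suc j) dvd (\<Sum>i<p ^ Suc j. u ^ i)"
    then have "p * p ^ Suc j dvd p * ((\<Sum>i<p ^ j. u ^ i) * (1 + p * t))"
      unfolding sum t by (simp only: mult.left_commute power_Suc)
    then have "p ^ Suc j dvd (\<Sum>i<p ^ j. u ^ i) * (1 + p * t)"
      using prime_gt_0_nat[OF p(1)] nat_mult_dvd_cancel1 by blast
    moreover have "coprime (p ^ Suc j) (1 + p * t)"
    proof -
      have "coprime p (1 + p * t)"
        by (rule coprimeI) (metis dvd_add_left_iff dvd_mult2)
      then show ?thesis by simp
    qed
    ultimately show False
      using Suc coprime_dvd_mult_left_iff by blast
  qed
qed

text \<open>Each multiplicity is below \<open>n\<close>, so the crude exponent \<open>n\<close>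
  suffices. It bounds the number of steps in
  \<open>nilpotent_if_prime_torsion_central\<close>.\<close>

lemma dvd_prod_prime_factors_pow:
  fixes n :: nat
  assumes "n > 0"
  shows "n dvd \<Prod>(prime_factors n) ^ n"
proof -
  have "n = (\<Prod>l\<in>prime_factors n. l ^ multiplicity l n)"
    using assms by (simp add: prime_factorization_nat)
  also have "\<dots> dvd (\<Prod>l\<in>prime_factors n. l ^ n)"
  proof (rule prod_dvd_prod)
    fix l assume "l \<in> prime_factors n"
    then have l: "Factorial_Ring.prime l" by auto
    have "multiplicity l n < l ^ multiplicity l n"
      using prime_gt_1_nat[OF l] by (intro less_le_trans[OF less_exp power_mono]) auto
    also have "\<dots> \<le> n"
      using assms by (simp add: dvd_imp_le multiplicity_dvd)
    finally show "l ^ multiplicity l n dvd l ^ n"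
      by (simp add: le_imp_power_dvd)
  qed
  also have "\<dots> = \<Prod>(prime_factors n) ^ n"
    by (simp add: prod_power_distrib)
  finally show ?thesis .
qed

section \<open>Cyclic, characteristic and central subgroups of finite groups\<close>

context group
begin

lemma ord_pos: "finite (carrier G) \<Longrightarrow> x \<in> carrier G \<Longrightarrow> 0 < ord x"
  using ord_ge_1 by fastforce

lemma generate_singleton_eq_range:
  assumes "finite (carrier G)" "c \<in> carrier G"
  shows "generate G {c} = range (\<lambda>i::nat. c [^] i)"
  using generate_pow_nat[OF assms(2)] ord_pos[OF assms] by auto

lemma subgroup_generate_singleton: "c \<in> carrier G \<Longrightarrow> subgroup (generate G {c}) G"
  by (simp add: generate_is_subgroup)

lemma nat_pow_eq_iff_cong:
  "x \<in> carrier G \<Longrightarrow> x [^] (i::nat) = x [^] (j::nat) \<longleftrightarrow> [i = j] (mod ord x)"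
  using int_pow_eq[of x "int i" "int j"]
  by (simp add: int_pow_int cong_iff_dvd_diff flip: cong_int_iff) (simp add: dvd_diff_commute)

lemma subgroup_nat_pow_closed: "subgroup H G \<Longrightarrow> h \<in> H \<Longrightarrow> h [^] (k::nat) \<in> H"
  using subgroup_int_pow_closed[of H h "int k"] by (simp add: int_pow_int)

lemma card_subgroup_dvd_order: "subgroup H G \<Longrightarrow> card H dvd order G"
  using lagrange by (metis dvd_triv_right)

lemma ord_dvd_card_subgroup:
  assumes "subgroup H G" "h \<in> H"
  shows "ord h dvd card H"
proof -
  interpret H: group "G\<lparr>carrier := H\<rparr>"
    using assms(1) by (rule subgroup_imp_group)
  have 1: "h [^]\<^bsub>G\<lparr>carrier := H\<rparr>\<^esub> order (G\<lparr>carrier := H\<rparr>) = \<one>\<^bsub>G\<lparr>carrier := H\<rparr>\<^esub>"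
    using assms(2) by (intro H.pow_order_eq_1) simp
  have 2: "order (G\<lparr>carrier := H\<rparr>) = card H" by (simp add: order_def)
  have 3: "\<one>\<^bsub>G\<lparr>carrier := H\<rparr>\<^esub> = \<one>" by simp
  have "h [^] card H = \<one>"
    using 1 unfolding 2 3 nat_pow_consistent[of h "card H" H, symmetric] .
  then show ?thesis
    using pow_eq_id[of h "card H"] subgroup.mem_carrier[OF assms] by simp
qed

lemma cyclic_subgroup_generator:
  assumes "subgroup H G" "cyclic_group (G\<lparr>carrier := H\<rparr>)"
  obtains c where "c \<in> carrier G" "H = generate G {c}"
proof -
  interpret H: group "G\<lparr>carrier := H\<rparr>"
    using assms(1) by (rule subgroup_imp_group)
  have H: "carrier (G\<lparr>carrier := H\<rparr>) = H" by simp
  obtain c where "c \<in> carrier (G\<lparr>carrier := H\<rparr>)"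
      "carrier (G\<lparr>carrier := H\<rparr>) = range (\<lambda>n::int. c [^]\<^bsub>G\<lparr>carrier := H\<rparr>\<^esub> n)"
    using H.cyclic_group[THEN iffD1, OF assms(2)] by (elim bexE)
  note c = this[unfolded H]
  have cG: "c \<in> carrier G"
    using subgroup.mem_carrier[OF assms(1) c(1)] .
  have "H = range (\<lambda>n::int. c [^] n)"
    using c(2) unfolding int_pow_consistent[OF assms(1) c(1), symmetric] .
  then have "H = generate G {c}"
    unfolding generate_pow[OF cG] by auto
  with cG show thesis by (rule that)
qed

lemma cyclic_group_generate_singleton:
  "c \<in> carrier G \<Longrightarrow> cyclic_group (G\<lparr>carrier := generate G {c}\<rparr>)"
  using cyclic_group_generated[of c] by (simp add: subgroup_generated_def)

text \<open>Both forms matter: the torsion set is visibly invariant under automorphisms, the other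
  side supplies a generator.\<close>

lemma torsion_of_cyclic:
  assumes fin: "finite (carrier G)" and c: "c \<in> carrier G" and d: "d dvd ord c"
  shows "{x \<in> generate G {c}. x [^] d = \<one>} = generate G {c [^] (ord c div d)}"
proof -
  obtain e where e: "ord c = d * e" using d by auto
  have pos: "0 < d" "0 < e" using ord_pos[OF fin c] e by auto
  have "c [^] i \<in> generate G {c [^] e}" if "(c [^] i) [^] d = \<one>" for i :: nat
  proof -
    have "e dvd i"
      using that c pos e by (simp add: nat_pow_pow pow_eq_id)
    then obtain j where "i = e * j" by auto
    then show ?thesis
      using c fin by (auto simp: generate_singleton_eq_range simp flip: nat_pow_pow)
  qed
  moreover have "((c [^] e) [^] i) [^] d = \<one>" "(c [^] e) [^] i \<in> generate G {c}" for i :: nat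
    using c e fin by (auto simp: nat_pow_pow pow_eq_id generate_singleton_eq_range)
  moreover have "x \<in> range (\<lambda>i::nat. c [^] i)" if "x \<in> generate G {c}" for x
    using that by (simp add: generate_singleton_eq_range[OF fin c])
  moreover have "x \<in> range (\<lambda>i::nat. (c [^] e) [^] i)" if "x \<in> generate G {c [^] e}" for x
    using that c by (simp add: generate_singleton_eq_range[OF fin])
  ultimately have "{x \<in> generate G {c}. x [^] d = \<one>} = generate G {c [^] e}"
    by blast
  then show ?thesis
    using e pos by simp
qed

lemma card_torsion_of_cyclic:
  assumes "finite (carrier G)" "c \<in> carrier G" "d dvd ord c"
  shows "card {x \<in> generate G {c}. x [^] d = \<one>} = d"
proof -
  obtain e where e: "ord c = d * e" using assms(3) by auto
  have pos: "0 < d" "0 < e" using ord_pos[OF assms(1,2)] e by auto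
  then have "card (generate G {c [^] e}) = d"
    using assms(2) e ord_pow[of c e] generate_pow_card[of "c [^] e"] by simp
  then show ?thesis
    using torsion_of_cyclic[OF assms] pos e by simp
qed

lemma cyclic_subgroup_commute:
  assumes "c \<in> carrier G" "x \<in> generate G {c}" "y \<in> generate G {c}"
  shows "x \<otimes> y = y \<otimes> x"
  using assms by (auto simp: generate_pow int_pow_mult[symmetric] add.commute simp flip: int_pow_mult)

lemma generate_singleton_pow_hom:
  assumes "finite (carrier G)" "c \<in> carrier G" "f \<in> hom G G" "f c = c [^] (u::nat)"
    and "x \<in> generate G {c}"
  shows "f x = x [^] u"
proof -
  interpret f: group_hom G G f
    using assms(3) by unfold_locales
  obtain i :: nat where "x = c [^] i"
    using assms by (auto simp: generate_singleton_eq_range)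
  then show ?thesis
    using assms f.hom_nat_pow[of c i] by (simp add: nat_pow_pow mult.commute)
qed

lemma characteristic_subgroupI:
  assumes "finite (carrier G)" "subgroup H G"
    and "\<And>f x. f \<in> iso G G \<Longrightarrow> x \<in> H \<Longrightarrow> f x \<in> H"
  shows "characteristic_subgroup H G"
  unfolding characteristic_subgroup_def
proof (intro conjI ballI)
  fix f assume f: "f \<in> iso G G"
  have H: "H \<subseteq> carrier G" using assms(2) by (rule subgroup.subset)
  have "inj_on f H"
    using f inj_on_subset[OF _ H] by (auto simp: iso_def bij_betw_def)
  then show "f ` H = H"
    using assms(3)[OF f] finite_subset[OF H assms(1)] endo_inj_surj by blast
qed (rule assms)

lemma characteristic_subgroup_imp_subgroup: "characteristic_subgroup H G \<Longrightarrow> subgroup H G"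
  by (simp add: characteristic_subgroup_def)

lemma characteristic_subgroup_image:
  "characteristic_subgroup H G \<Longrightarrow> f \<in> iso G G \<Longrightarrow> x \<in> H \<Longrightarrow> f x \<in> H"
  unfolding characteristic_subgroup_def by blast

lemma conjugation_iso:
  assumes g: "g \<in> carrier G"
  shows "(\<lambda>x. g \<otimes> x \<otimes> inv g) \<in> iso G G"
proof (rule isoI)
  show "(\<lambda>x. g \<otimes> x \<otimes> inv g) \<in> hom G G"
    using g by (auto intro!: homI simp: m_assoc inv_solve_left)
  show "bij_betw (\<lambda>x. g \<otimes> x \<otimes> inv g) (carrier G) (carrier G)"
    using g by (intro bij_betw_byWitness[where f' = "\<lambda>x. inv g \<otimes> x \<otimes> g"])
      (auto simp: m_assoc, (simp add: m_assoc[symmetric])+)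
qed

lemma characteristic_subgroup_imp_normal:
  assumes "characteristic_subgroup H G"
  shows "H \<lhd> G"
  using assms conjugation_iso characteristic_subgroup_image
  by (auto simp: normal_inv_iff characteristic_subgroup_imp_subgroup)

text \<open>Automorphisms preserve exponents; commutativity of \<open>C\<close> closes the torsion
  set under products.\<close>

lemma characteristic_torsion:
  assumes fin: "finite (carrier G)" and C: "characteristic_subgroup C G"
    and comm: "\<And>x y. x \<in> C \<Longrightarrow> y \<in> C \<Longrightarrow> x \<otimes> y = y \<otimes> x"
  shows "characteristic_subgroup {x \<in> C. x [^] (d::nat) = \<one>} G"
proof (rule characteristic_subgroupI[OF fin])
  interpret C: subgroup C G
    using C by (rule characteristic_subgroup_imp_subgroup)
  show "subgroup {x \<in> C. x [^] d = \<one>} G"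
    by (rule subgroupI) (use C.subset comm in \<open>auto simp: nat_pow_inv pow_mult_distrib intro!: exI[of _ \<one>]\<close>)
next
  fix f x assume f: "f \<in> iso G G" and x: "x \<in> {x \<in> C. x [^] d = \<one>}"
  interpret f: group_hom G G f
    using f by unfold_locales (simp add: iso_def)
  have "x \<in> carrier G"
    using x subgroup.mem_carrier[OF characteristic_subgroup_imp_subgroup[OF C]] by auto
  then show "f x \<in> {x \<in> C. x [^] d = \<one>}"
    using x characteristic_subgroup_image[OF C f] f.hom_nat_pow[of x d] by auto
qed

section \<open>Centralizers, the derived subgroup and commutative quotients\<close>

definition centralizer :: "'a set \<Rightarrow> 'a set"
  where "centralizer S = {x \<in> carrier G. \<forall>s \<in> S. x \<otimes> s = s \<otimes> x}"

lemma subgroup_centralizer: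
  assumes "S \<subseteq> carrier G"
  shows "subgroup (centralizer S) G"
proof (rule subgroupI)
  fix x assume x: "x \<in> centralizer S"
  have "inv x \<otimes> s = s \<otimes> inv x" if "s \<in> S" for s
  proof -
    have "s \<in> carrier G" "x \<in> carrier G" "x \<otimes> s = s \<otimes> x"
      using that x assms by (auto simp: centralizer_def)
    then show ?thesis
      by (simp add: inv_solve_left inv_solve_right m_assoc)
  qed
  then show "inv x \<in> centralizer S"
    using x by (auto simp: centralizer_def)
next
  fix x y assume "x \<in> centralizer S" "y \<in> centralizer S"
  then show "x \<otimes> y \<in> centralizer S"
    using assms by (auto simp: centralizer_def) (metis m_assoc subsetD)
qed (use assms in \<open>auto simp: centralizer_def intro!: exI[of _ \<one>]\<close>)

lemma characteristic_centralizer: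
  assumes fin: "finite (carrier G)" and S: "characteristic_subgroup S G"
  shows "characteristic_subgroup (centralizer S) G"
proof (rule characteristic_subgroupI[OF fin])
  have sub: "S \<subseteq> carrier G"
    using S by (simp add: characteristic_subgroup_def subgroup.subset)
  then show "subgroup (centralizer S) G"
    by (rule subgroup_centralizer)
  fix f x assume f: "f \<in> iso G G" and x: "x \<in> centralizer S"
  interpret f: group_hom G G f
    using f by unfold_locales (simp add: iso_def)
  have "f x \<otimes> f s = f s \<otimes> f x" if "s \<in> S" for s
    using x that sub by (auto simp: centralizer_def simp flip: f.hom_mult)
  moreover have "f ` S = S"
    using S f by (simp add: characteristic_subgroup_def)
  ultimately show "f x \<in> centralizer S"
    using x by (auto simp: centralizer_def) (metis imageE)
qed

lemma characteristic_derived: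
  assumes fin: "finite (carrier G)"
  shows "characteristic_subgroup (derived G (carrier G)) G"
  unfolding characteristic_subgroup_def
proof (intro conjI ballI)
  show "subgroup (derived G (carrier G)) G"
    by (rule derived_is_subgroup) simp
  fix f assume f: "f \<in> iso G G"
  interpret f: group_hom G G f
    using f by unfold_locales (simp add: iso_def)
  have "f ` carrier G = carrier G"
    using f by (simp add: iso_def bij_betw_def)
  then show "f ` derived G (carrier G) = derived G (carrier G)"
    using f.derived_img[of "carrier G"] by simp
qed

lemma commutator_in_derived:
  "x \<in> carrier G \<Longrightarrow> y \<in> carrier G \<Longrightarrow> x \<otimes> y \<otimes> inv x \<otimes> inv y \<in> derived G (carrier G)"
  unfolding derived_def by (rule generate.incl) blast

lemma comm_FactGroup_if_derived_subset:
  assumes N: "N \<lhd> G" and D: "derived G (carrier G) \<subseteq> N"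
  shows "comm_group (G Mod N)"
proof -
  interpret N: normal N G by (rule N)
  interpret Q: group "G Mod N" by (rule N.factorgroup_is_group)
  show ?thesis
  proof (rule Q.group_comm_groupI)
    fix u v assume "u \<in> carrier (G Mod N)" "v \<in> carrier (G Mod N)"
    then obtain x y where xy: "x \<in> carrier G" "y \<in> carrier G" "u = N #> x" "v = N #> y"
      by (auto simp: FactGroup_def RCOSETS_def)
    have "x \<otimes> y = (x \<otimes> y \<otimes> inv x \<otimes> inv y) \<otimes> (y \<otimes> x)"
      using xy by (simp add: m_assoc inv_solve_left flip: inv_mult_group)
    moreover have "x \<otimes> y \<otimes> inv x \<otimes> inv y \<in> N"
      using commutator_in_derived[OF xy(1,2)] D by blast
    ultimately have "N #> (x \<otimes> y) = N #> (y \<otimes> x)"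
      using xy coset_join2[OF _ N.subgroup_axioms]
      by (metis N.mem_carrier N.subset coset_mult_assoc m_closed)
    then show "u \<otimes>\<^bsub>G Mod N\<^esub> v = v \<otimes>\<^bsub>G Mod N\<^esub> u"
      using xy by (simp add: FactGroup_def N.rcos_sum)
  qed
qed

lemma FactGroup_pow_eq_one_iff:
  assumes N: "N \<lhd> G" and x: "x \<in> carrier G"
  shows "(N #> x) [^]\<^bsub>G Mod N\<^esub> (n::nat) = \<one>\<^bsub>G Mod N\<^esub> \<longleftrightarrow> x [^] n \<in> N"
proof -
  interpret N: normal N G by (rule N)
  show ?thesis
    using N.FactGroup_pow[OF x, of n] x
    by (simp add: FactGroup_def) (metis N.rcos_const N.subgroup_axioms coset_join1 is_group nat_pow_closed N.subset)
qed

text \<open>In a commutative quotient the \<open>n\<close>-torsion is a subgroup, and its preimage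
  inherits invariance from \<open>N\<close>. This produces characteristic subgroups above a given
  one, to which the CCS hypothesis can be applied.\<close>

lemma characteristic_preimage_torsion:
  assumes fin: "finite (carrier G)" and N: "characteristic_subgroup N G"
    and comm: "comm_group (G Mod N)"
  shows "characteristic_subgroup {x \<in> carrier G. x [^] (n::nat) \<in> N} G"
proof (rule characteristic_subgroupI[OF fin])
  have nN: "N \<lhd> G" using N by (rule characteristic_subgroup_imp_normal)
  interpret N: normal N G by (rule nN)
  interpret Q: comm_group "G Mod N" by (rule comm)
  have mult: "(x \<otimes> y) [^] n \<in> N" if "x \<in> carrier G" "y \<in> carrier G" "x [^] n \<in> N" "y [^] n \<in> N" for x y
  proof -
    have X: "N #> x \<in> carrier (G Mod N)" "N #> y \<in> carrier (G Mod N)"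
      using that by (auto simp: FactGroup_def RCOSETS_def)
    have "(N #> (x \<otimes> y)) [^]\<^bsub>G Mod N\<^esub> n = ((N #> x) \<otimes>\<^bsub>G Mod N\<^esub> (N #> y)) [^]\<^bsub>G Mod N\<^esub> n"
      using that by (simp add: FactGroup_def N.rcos_sum)
    also have "\<dots> = \<one>\<^bsub>G Mod N\<^esub>"
      unfolding Q.nat_pow_distrib[OF X]
      using that FactGroup_pow_eq_one_iff[OF nN, of x n] FactGroup_pow_eq_one_iff[OF nN, of y n] Q.l_one[OF Q.one_closed]
      by metis
    finally show ?thesis
      using that FactGroup_pow_eq_one_iff[OF nN] by simp
  qed
  show "subgroup {x \<in> carrier G. x [^] n \<in> N} G"
    by (rule subgroupI) (auto simp: nat_pow_inv mult intro!: exI[of _ \<one>])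
  fix f x assume f: "f \<in> iso G G" and x: "x \<in> {x \<in> carrier G. x [^] n \<in> N}"
  interpret f: group_hom G G f
    using f by unfold_locales (simp add: iso_def)
  show "f x \<in> {x \<in> carrier G. x [^] n \<in> N}"
    using x characteristic_subgroup_image[OF N f] f.hom_nat_pow[of x n] by fastforce
qed

lemma FactGroup_prime_order_coset:
  assumes N: "N \<lhd> G" and fin: "finite (carrier G)"
    and p: "Factorial_Ring.prime p" "order G = p * card N"
    and x: "x \<in> carrier G" "x \<notin> N"
  shows "group.ord (G Mod N) (N #> x) = p"
    and "y \<in> carrier G \<Longrightarrow> \<exists>k::nat. N #> y = N #> (x [^] k)"
proof -
  interpret N: normal N G by (rule N)
  interpret Q: group "G Mod N" by (rule N.factorgroup_is_group)
  have "card N > 0"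
    using N.finite_imp_card_positive[OF fin] .
  then have order: "order (G Mod N) = p"
    using lagrange[OF N.subgroup_axioms] p by (simp add: order_def FactGroup_def)
  then have finQ: "finite (carrier (G Mod N))"
    using prime_gt_0_nat[OF p(1)] Q.order_gt_0_iff_finite by simp
  have X: "N #> z \<in> carrier (G Mod N)" if "z \<in> carrier G" for z
    using that by (auto simp: FactGroup_def RCOSETS_def)
  have "Q.ord (N #> x) \<noteq> 1"
  proof
    assume "Q.ord (N #> x) = 1"
    then have "(N #> x) [^]\<^bsub>G Mod N\<^esub> (1::nat) = \<one>\<^bsub>G Mod N\<^esub>"
      using X[OF x(1)] Q.pow_eq_id[of "N #> x" 1] by (simp del: mult_FactGroup one_FactGroup)
    then show False
      using FactGroup_pow_eq_one_iff[OF N x(1), of 1] x by simp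
  qed
  then show ord: "Q.ord (N #> x) = p"
    using Q.ord_dvd_group_order[OF X[OF x(1)]] order p(1) by (metis prime_nat_iff)
  assume y: "y \<in> carrier G"
  have "generate (G Mod N) {N #> x} = carrier (G Mod N)"
    using Q.generate_incl[of "{N #> x}"] X[OF x(1)] finQ Q.generate_pow_card[OF X[OF x(1)]] ord order
    by (intro card_subset_eq) (auto simp: order_def)
  then obtain k :: nat where "N #> y = (N #> x) [^]\<^bsub>G Mod N\<^esub> k"
    using X[OF y] Q.generate_singleton_eq_range[OF finQ X[OF x(1)]] by blast
  then show "\<exists>k::nat. N #> y = N #> (x [^] k)"
    using N.FactGroup_pow[OF x(1)] by auto
qed

end

section \<open>Conjugation on a cyclic normal subgroup\<close>

context group
begin

lemma conjugation_hom: "g \<in> carrier G \<Longrightarrow> (\<lambda>x. g \<otimes> x \<otimes> inv g) \<in> hom G G"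
  using conjugation_iso by (simp add: iso_def)

lemma conjugation_nat_pow:
  assumes "g \<in> carrier G" "x \<in> carrier G"
  shows "g \<otimes> x [^] (k::nat) \<otimes> inv g = (g \<otimes> x \<otimes> inv g) [^] k"
proof -
  interpret f: group_hom G G "\<lambda>x. g \<otimes> x \<otimes> inv g"
    using conjugation_hom[OF assms(1)] by unfold_locales
  show ?thesis using f.hom_nat_pow[OF assms(2)] by simp
qed

lemma conjugation_nat_pow_iterate:
  assumes g: "g \<in> carrier G" and x: "x \<in> carrier G" and u: "g \<otimes> x \<otimes> inv g = x [^] (u::nat)"
  shows "g [^] k \<otimes> x \<otimes> inv (g [^] k) = x [^] (u ^ k)"
proof (induction k)
  case (Suc k)
  have "g [^] Suc k \<otimes> x \<otimes> inv (g [^] Suc k) = g \<otimes> (g [^] k \<otimes> x \<otimes> inv (g [^] k)) \<otimes> inv g"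
    using g x by (simp only: nat_pow_Suc2) (simp add: inv_mult_group m_assoc)
  also have "\<dots> = (x [^] u) [^] (u ^ k)"
    using g x u by (simp add: Suc conjugation_nat_pow)
  finally show ?case
    using x by (simp add: nat_pow_pow)
qed (use x in simp)

lemma commute_iff_conjugate_eq:
  assumes "g \<in> carrier G" "x \<in> carrier G"
  shows "g \<otimes> x = x \<otimes> g \<longleftrightarrow> g \<otimes> x \<otimes> inv g = x"
  using assms by (metis inv_solve_right' m_closed)

lemma conjugate_in_cyclic_normal:
  assumes "finite (carrier G)" "c \<in> carrier G" "generate G {c} \<lhd> G" "g \<in> carrier G"
  obtains u :: nat where "g \<otimes> c \<otimes> inv g = c [^] u"
proof -
  have "c \<in> generate G {c}" by (rule generate.incl) simp
  then have "g \<otimes> c \<otimes> inv g \<in> generate G {c}"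
    using assms(3,4) by (auto simp: normal_inv_iff)
  then show thesis
    using that by (auto simp: generate_singleton_eq_range[OF assms(1,2)])
qed

lemma derived_eq_lower_central_series:
  "lower_central_series G (Suc 0) = derived G (carrier G)"
  by (simp add: derived_def)

text \<open>The element \<open>c [^] (ord c div l)\<close> has order \<open>l\<close>, so commuting
  with it fixes the exponent \<open>u\<close> modulo \<open>l\<close>. Besides primes,
  \<open>l\<close> will also be a full prime-power part of \<open>ord c\<close> or its
  cofactor.\<close>

lemma conjugation_cong_1:
  assumes c: "c \<in> carrier G" and g: "g \<in> carrier G" and l: "l dvd ord c" and pos: "0 < ord c"
    and u: "g \<otimes> c \<otimes> inv g = c [^] (u::nat)"
    and central: "g \<otimes> c [^] (ord c div l) = c [^] (ord c div l) \<otimes> g"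
  shows "[u = 1] (mod l)"
proof -
  obtain e where e: "ord c = l * e" using l by auto
  then have "0 < e" "ord c div l = e" using pos by auto
  have "c [^] e = g \<otimes> c [^] e \<otimes> inv g"
    using central c g \<open>ord c div l = e\<close> by (simp add: commute_iff_conjugate_eq)
  also have "\<dots> = c [^] (u * e)"
    using c g u by (simp add: conjugation_nat_pow nat_pow_pow)
  finally have "[u * e = 1 * e] (mod (l * e))"
    using c e by (simp add: nat_pow_eq_iff_cong cong_sym_eq)
  then have "(u mod l) * e = (1 mod l) * e"
    unfolding cong_def by (simp only: mod_mult_mult2)
  then show ?thesis
    using \<open>0 < e\<close> by (simp add: cong_def)
qed

text \<open>Every conjugation raises \<open>c\<close> to a power \<open>1 + R * t\<close>, with
  \<open>R\<close> the radical of \<open>ord c\<close>. So a commutator with an element of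
  \<open>generate G {c [^] (R ^ j)}\<close> lies in \<open>generate G {c [^] (R ^ Suc j)}\<close>,
  and a high power of \<open>R\<close> is divisible by \<open>ord c\<close>.\<close>

lemma nilpotent_if_prime_torsion_central:
  assumes fin: "finite (carrier G)" and c: "c \<in> carrier G"
    and normal: "generate G {c} \<lhd> G" and derived: "derived G (carrier G) \<subseteq> generate G {c}"
    and central: "\<And>l g. Factorial_Ring.prime l \<Longrightarrow> l dvd ord c \<Longrightarrow> g \<in> carrier G \<Longrightarrow>
      g \<otimes> c [^] (ord c div l) = c [^] (ord c div l) \<otimes> g"
  shows "nilpotent_group G"
proof -
  define R where "R = \<Prod>(prime_factors (ord c))"
  have pos: "0 < ord c" using fin c by (rule ord_pos)
  have act: "\<exists>t. g \<otimes> c \<otimes> inv g = c [^] (1 + R * t)" if g: "g \<in> carrier G" for g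
  proof -
    obtain u0 :: nat where u0: "g \<otimes> c \<otimes> inv g = c [^] u0"
      by (rule conjugate_in_cyclic_normal[OF fin c normal g])
    \<comment> \<open>Adding \<open>ord c\<close> keeps the power of \<open>c\<close> and makes the
      exponent positive, so that \<open>u - 1\<close> is an honest difference of natural
      numbers.\<close>
    define u where "u = u0 + ord c"
    have u: "g \<otimes> c \<otimes> inv g = c [^] u"
      using c by (simp add: u0 u_def nat_pow_eq_iff_cong cong_def)
    have "[u = 1] (mod \<Prod>(prime_factors (ord c)))"
    proof (rule cong_cong_prod_coprime_nat[where m = "\<lambda>l. l", unfolded image_ident])
      show "\<forall>l\<in>prime_factors (ord c). [u = 1] (mod l)"
        using conjugation_cong_1[OF c g _ pos u] central g by auto
      show "\<forall>i\<in>prime_factors (ord c). \<forall>j\<in>prime_factors (ord c). i \<noteq> j \<longrightarrow> coprime i j"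
        using primes_coprime_nat by auto
    qed
    then have "R dvd u - 1"
      unfolding R_def by (rule cong_to_1_nat)
    then obtain t where "u - 1 = R * t" by auto
    then have "u = 1 + R * t"
      using pos u_def by simp
    then show ?thesis using u by auto
  qed
  have "lower_central_series G (Suc j) \<subseteq> generate G {c [^] (R ^ j)}" for j
  proof (induction j)
    case 0
    then show ?case
      using derived derived_eq_lower_central_series c by simp
  next
    case (Suc j)
    have cR: "c [^] (R ^ k) \<in> carrier G" for k using c by simp
    have comm: "h \<otimes> g \<otimes> inv h \<otimes> inv g \<in> generate G {c [^] (R ^ Suc j)}"
      if h: "h \<in> lower_central_series G (Suc j)" and g: "g \<in> carrier G" for h g
    proof -
      obtain i :: nat where "h = (c [^] (R ^ j)) [^] i"
        using Suc h generate_singleton_eq_range[OF fin cR] by blast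
      then have hc: "h = c [^] (R ^ j * i)"
        using c by (simp add: nat_pow_pow)
      then have hG: "h \<in> carrier G" using c by simp
      obtain t where t: "g \<otimes> c \<otimes> inv g = c [^] (1 + R * t)"
        using act[OF g] by blast
      have "g \<otimes> h \<otimes> inv g = h [^] (1 + R * t)"
        unfolding hc conjugation_nat_pow[OF g c] t
        using c by (simp only: nat_pow_pow mult.commute)
      then have ghg: "g \<otimes> h \<otimes> inv g = h [^] (R * t) \<otimes> h"
        by simp
      have "h \<otimes> g \<otimes> inv h \<otimes> inv g = h \<otimes> inv (g \<otimes> h \<otimes> inv g)"
        using hG g by (simp add: inv_mult_group m_assoc)
      also have "\<dots> = inv (h [^] (R * t))"
        unfolding ghg using hG by (simp add: inv_mult_group flip: m_assoc)
      also have "h [^] (R * t) = (c [^] (R ^ Suc j)) [^] (i * t)"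
        unfolding hc using c by (simp add: nat_pow_pow mult.assoc mult.commute mult.left_commute)
      finally show ?thesis
        using generate_m_inv_closed[of "{c [^] (R ^ Suc j)}"] cR generate_singleton_eq_range[OF fin cR, of "Suc j"]
        by (metis empty_subsetI insert_subset rangeI)
    qed
    show ?case
      unfolding lower_central_series.simps(2)[of G "Suc j"]
    proof (rule generate_subgroup_incl)
      show "subgroup (generate G {c [^] (R ^ Suc j)}) G"
        using subgroup_generate_singleton[OF cR] .
    qed (intro UN_least, simp only: comm insert_subset empty_subsetI simp_thms)
  qed
  then have "lower_central_series G (Suc (ord c)) \<subseteq> generate G {c [^] (R ^ ord c)}" .
  also have "c [^] (R ^ ord c) = \<one>"
    using dvd_prod_prime_factors_pow[OF pos] c by (simp add: pow_eq_id R_def)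
  finally have "lower_central_series G (Suc (ord c)) \<subseteq> {\<one>}"
    by (simp add: generate_one)
  moreover have "\<one> \<in> lower_central_series G (Suc (ord c))"
    by (simp add: generate.one)
  ultimately have "lower_central_series G (Suc (ord c)) = {\<one>}" by blast
  then show ?thesis
    unfolding nilpotent_group_def using is_group by blast
qed

text \<open>Conjugation by \<open>inv y\<close> sends \<open>z\<close> to a power \<open>z [^] u\<close> with \<open>u ^ r = 1\<close> modulo the prime
  \<open>ord z\<close>, and \<open>u\<close> determines the coset of \<open>y\<close>; a polynomial has at most as many roots as its degree.\<close>

lemma card_rcosets_centralizer_le:
  assumes fin: "finite (carrier G)" and z: "z \<in> carrier G" and l: "Factorial_Ring.prime (ord z)"
    and normal: "generate G {z} \<lhd> G"
    and pow: "\<And>y. y \<in> carrier G \<Longrightarrow> y [^] (r::nat) \<in> centralizer {z}" and r: "0 < r"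
  shows "card (rcosets (centralizer {z})) \<le> r"
proof -
  let ?C = "centralizer {z}"
  let ?l = "ord z"
  interpret C: subgroup ?C G
    using z by (intro subgroup_centralizer) simp
  have "\<forall>y\<in>carrier G. \<exists>u. u < ?l \<and> inv y \<otimes> z \<otimes> inv (inv y) = z [^] u"
  proof
    fix y assume "y \<in> carrier G"
    then have "inv y \<in> carrier G" by simp
    from conjugate_in_cyclic_normal[OF fin z normal this]
    obtain u :: nat where u: "inv y \<otimes> z \<otimes> inv (inv y) = z [^] u" .
    have "z [^] u = z [^] (u mod ?l)"
      unfolding nat_pow_eq_iff_cong[OF z] by (simp add: cong_def)
    with u have "inv y \<otimes> z \<otimes> inv (inv y) = z [^] (u mod ?l)"
      by simp
    then show "\<exists>u. u < ?l \<and> inv y \<otimes> z \<otimes> inv (inv y) = z [^] u"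
      using prime_gt_0_nat[OF l] by (intro exI[of _ "u mod ?l"]) simp
  qed
  from bchoice[OF this]
  obtain u where "\<forall>y\<in>carrier G. u y < ?l \<and> inv y \<otimes> z \<otimes> inv (inv y) = z [^] (u y)" ..
  note u = this[THEN bspec, THEN conjunct1] this[THEN bspec, THEN conjunct2]
  have "[u y ^ r = 1] (mod ?l)" if y: "y \<in> carrier G" for y
  proof -
    have iy: "inv y \<in> carrier G" using y by simp
    have "inv y [^] r \<in> ?C" using pow[OF iy] .
    then have "inv y [^] r \<otimes> z = z \<otimes> inv y [^] r"
      unfolding centralizer_def by blast
    then have "inv y [^] r \<otimes> z \<otimes> inv (inv y [^] r) = z"
      using commute_iff_conjugate_eq[OF nat_pow_closed[OF iy] z] by blast
    then have "z [^] (u y ^ r) = z [^] (1::nat)"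
      unfolding conjugation_nat_pow_iterate[OF iy z u(2)[OF y], of r] using z by simp
    then show ?thesis
      unfolding nat_pow_eq_iff_cong[OF z] .
  qed
  then have "u ` carrier G \<subseteq> {x \<in> {..<?l}. [x ^ r = 1] (mod ?l)}"
    using u(1) by auto
  then have "card (u ` carrier G) \<le> card {x \<in> {..<?l}. [x ^ r = 1] (mod ?l)}"
    by (intro card_mono) auto
  also have "\<dots> \<le> r"
    using l r by (rule roots_mod_prime_bound)
  finally have "card (u ` carrier G) \<le> r" .
  moreover have "card (rcosets ?C) \<le> card (u ` carrier G)"
  proof -
    \<comment> \<open>Conjugating by \<open>inv y\<close> rather than by \<open>y\<close> suits
      right cosets: equal exponents put \<open>y' \<otimes> inv y\<close>, not
      \<open>inv y' \<otimes> y\<close>, into the centralizer.\<close>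
    have "?C #> y = ?C #> y'" if y: "y \<in> carrier G" "y' \<in> carrier G" "u y = u y'" for y y'
    proof -
      have eq: "inv y \<otimes> z \<otimes> y = inv y' \<otimes> z \<otimes> y'"
        using u(2)[OF y(1)] u(2)[OF y(2)] y by simp
      have "y' \<otimes> inv y \<otimes> z = y' \<otimes> (inv y \<otimes> z \<otimes> y) \<otimes> inv y"
        using y z by (simp add: m_assoc)
      also have "\<dots> = z \<otimes> (y' \<otimes> inv y)"
        unfolding eq using y z by (simp add: m_assoc[symmetric])
      finally have "y' \<otimes> inv y \<in> ?C"
        unfolding centralizer_def using y(1,2) by blast
      then have "y' \<in> ?C #> y"
        using C.rcos_module_rev[OF is_group y(1,2)] by simp
      then show ?thesis
        using repr_independence[OF _ y(1) C.subgroup_axioms] by simp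
    qed
    then have "(\<lambda>y. ?C #> y) ` carrier G = (\<lambda>v. ?C #> (SOME y. y \<in> carrier G \<and> u y = v)) ` (u ` carrier G)"
      unfolding image_image
      by (intro image_cong refl) (metis (mono_tags, lifting) someI_ex)
    moreover have "rcosets ?C = (\<lambda>y. ?C #> y) ` carrier G"
      by (auto simp: RCOSETS_def)
    ultimately show ?thesis
      using card_image_le[of "u ` carrier G"] fin by simp
  qed
  ultimately show ?thesis by simp
qed

end

section \<open>Non-nilpotent, non-perfect CCS groups\<close>

locale ccs_nonnilpotent_nonperfect = group G for G (structure) +
  assumes ccs: "CCS_group G" and non_nilpotent: "\<not> nilpotent_group G"
    and non_perfect: "\<not> perfect_group G"
begin

lemma fin: "finite (carrier G)"
  using ccs by (simp add: CCS_group_def)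

definition C :: "'a set"
  where "C = centralizer (derived G (carrier G))"

lemma characteristic_subgroup_generator:
  assumes "characteristic_subgroup H G" "H \<noteq> carrier G"
  obtains c where "c \<in> carrier G" "H = generate G {c}"
  using cyclic_subgroup_generator[of H] assms ccs characteristic_subgroup_imp_subgroup
  unfolding CCS_group_def by blast

lemma derived_proper: "derived G (carrier G) \<noteq> carrier G"
  using non_perfect is_group unfolding perfect_group_def by blast

text \<open>The derived subgroup is cyclic, hence abelian, so it centralizes itself.\<close>

lemma derived_subset_C: "derived G (carrier G) \<subseteq> C"
proof -
  obtain d where d: "d \<in> carrier G" "derived G (carrier G) = generate G {d}"
    using characteristic_subgroup_generator[OF characteristic_derived[OF fin] derived_proper] .
  then show ?thesis
    using cyclic_subgroup_commute[OF d(1)] generate_incl[of "{d}"]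
    unfolding C_def centralizer_def by blast
qed

lemma characteristic_C: "characteristic_subgroup C G"
  unfolding C_def by (rule characteristic_centralizer[OF fin characteristic_derived[OF fin]])

text \<open>Otherwise the derived subgroup would be central and the next term of the lower central
  series trivial, against non-nilpotency.\<close>

lemma C_proper: "C \<noteq> carrier G"
proof
  assume C: "C = carrier G"
  have "h \<otimes> g \<otimes> inv h \<otimes> inv g = \<one>" if "h \<in> derived G (carrier G)" "g \<in> carrier G" for h g
  proof -
    have h: "h \<in> carrier G"
      using derived_in_carrier[of "carrier G"] that(1) by blast
    have "g \<in> C" using that(2) C by simp
    then have "g \<otimes> h = h \<otimes> g"
      using that(1) unfolding C_def centralizer_def by blast
    then show ?thesis
      using h that(2) by (metis inv_solve_right' m_closed inv_closed r_inv m_assoc)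
  qed
  then have "(\<Union>h\<in>derived G (carrier G). \<Union>g\<in>carrier G. {h \<otimes> g \<otimes> inv h \<otimes> inv g}) \<subseteq> {\<one>}"
    by (intro UN_least) (simp only: insert_subset empty_subsetI simp_thms singleton_iff)
  then have "lower_central_series G (Suc (Suc 0)) \<subseteq> generate G {\<one>}"
    unfolding lower_central_series.simps(2)[of G "Suc 0"] derived_eq_lower_central_series
    by (rule mono_generate)
  moreover have "\<one> \<in> lower_central_series G (Suc (Suc 0))"
    by (simp add: generate.one)
  ultimately have "lower_central_series G (Suc (Suc 0)) = {\<one>}"
    unfolding generate_one by blast
  then show False
    using non_nilpotent is_group unfolding nilpotent_group_def by blast
qed

text \<open>Being cyclic, \<open>H\<close> is abelian; it contains the derived subgroup together
  with \<open>C\<close>, and therefore centralizes it.\<close>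

lemma characteristic_above_C:
  assumes "characteristic_subgroup H G" "C \<subseteq> H" "H \<noteq> carrier G"
  shows "H = C"
proof -
  obtain h where h: "h \<in> carrier G" "H = generate G {h}"
    using characteristic_subgroup_generator[OF assms(1,3)] .
  have "x \<in> C" if "x \<in> H" for x
    unfolding C_def centralizer_def
    using that h(2) generate_incl[of "{h}"] h(1) cyclic_subgroup_commute[OF h(1)] derived_subset_C assms(2)
    by blast
  then show ?thesis using assms(2) by blast
qed

lemma comm_FactGroup_C: "comm_group (G Mod C)"
  using comm_FactGroup_if_derived_subset[OF characteristic_subgroup_imp_normal[OF characteristic_C] derived_subset_C] .

lemma exists_prime_exponent_mod_C:
  obtains r x where "Factorial_Ring.prime r" "x \<in> carrier G" "x \<notin> C"
    "\<And>y. y \<in> carrier G \<Longrightarrow> y [^] (r::nat) \<in> C"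
proof -
  have nC: "C \<lhd> G" using characteristic_subgroup_imp_normal[OF characteristic_C] .
  interpret C: normal C G by (rule nC)
  obtain x0 where x0: "x0 \<in> carrier G" "x0 \<notin> C"
    using C_proper C.subset by blast
  \<comment> \<open>\<open>k\<close> is the order of the coset of \<open>x0\<close> modulo
    \<open>C\<close>. For a prime \<open>r\<close> dividing \<open>k\<close>, the power of
    \<open>x0\<close> with exponent \<open>k div r\<close> lies outside \<open>C\<close>, while its
    \<open>r\<close>-th power lies inside.\<close>
  define k where "k = (LEAST k. 0 < k \<and> x0 [^] (k::nat) \<in> C)"
  have "0 < ord x0 \<and> x0 [^] ord x0 \<in> C"
    using ord_pos[OF fin x0(1)] x0(1) by simp
  then have k: "0 < k" "x0 [^] k \<in> C"
    unfolding k_def by (rule LeastI2; simp)+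
  have least: "x0 [^] j \<notin> C" if "0 < j" "j < k" for j
    using that not_less_Least unfolding k_def by blast
  have "k \<noteq> 1" using k(2) x0 by (cases "k = 1") auto
  then obtain r where r: "Factorial_Ring.prime r" "r dvd k"
    using prime_factor_nat by blast
  then obtain j where j: "k = r * j" by auto
  define x where "x = x0 [^] j"
  have "0 < j" "j < k"
    using k(1) j prime_gt_1_nat[OF r(1)] by auto
  then have x: "x \<in> carrier G" "x \<notin> C"
    using x0(1) least unfolding x_def by auto
  have xr: "x [^] r \<in> C"
    using k(2) x0(1) j unfolding x_def by (simp add: nat_pow_pow mult.commute)
  \<comment> \<open>The preimage of the \<open>r\<close>-torsion of \<open>G Mod C\<close> is
    characteristic and properly contains \<open>C\<close>, so \<open>characteristic_above_C\<close>
    leaves only the whole group.\<close>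
  let ?T = "{y \<in> carrier G. y [^] r \<in> C}"
  have "characteristic_subgroup ?T G"
    using characteristic_preimage_torsion[OF fin characteristic_C comm_FactGroup_C] .
  moreover have "C \<subseteq> ?T"
    using subgroup_nat_pow_closed[OF C.subgroup_axioms] C.subset by blast
  moreover have "?T \<noteq> C" using x xr by blast
  ultimately have "?T = carrier G"
    using characteristic_above_C by blast
  then show thesis
    using that r(1) x by blast
qed

text \<open>By \<open>nilpotent_if_prime_torsion_central\<close>, non-nilpotency yields an element
  \<open>z\<close> of prime order in \<open>C\<close> that some \<open>g\<close> does not
  centralize. The centralizer of \<open>z\<close> is characteristic because
  \<open>generate G {z}\<close> is, contains \<open>C\<close> because \<open>C\<close> is abelian,
  and is proper; so it is \<open>C\<close>.\<close>

lemma exists_centralizer_eq_C: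
  assumes c: "c \<in> carrier G" "C = generate G {c}"
  obtains z where "z \<in> carrier G" "Factorial_Ring.prime (ord z)"
    "characteristic_subgroup (generate G {z}) G" "centralizer {z} = C"
proof -
  have nC: "generate G {c} \<lhd> G"
    using characteristic_subgroup_imp_normal[OF characteristic_C] c(2) by simp
  obtain l g where l: "Factorial_Ring.prime l" "l dvd ord c" and g: "g \<in> carrier G"
      and neq: "g \<otimes> c [^] (ord c div l) \<noteq> c [^] (ord c div l) \<otimes> g"
    using nilpotent_if_prime_torsion_central[OF fin c(1) nC] derived_subset_C c(2) non_nilpotent
    by blast
  define z where "z = c [^] (ord c div l)"
  have z: "z \<in> carrier G" using c(1) by (simp add: z_def)
  have comm: "x \<otimes> y = y \<otimes> x" if "x \<in> C" "y \<in> C" for x y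
    using cyclic_subgroup_commute[OF c(1)] that c(2) by blast
  have tors: "{x \<in> C. x [^] l = \<one>} = generate G {z}"
    unfolding c(2) z_def by (rule torsion_of_cyclic[OF fin c(1) l(2)])
  have char: "characteristic_subgroup (generate G {z}) G"
    using characteristic_torsion[OF fin characteristic_C comm, of l] unfolding tors .
  have "ord z = l"
    using card_torsion_of_cyclic[OF fin c(1) l(2)] generate_pow_card[OF z] tors c(2) by simp
  then have prime: "Factorial_Ring.prime (ord z)" using l(1) by simp
  have "centralizer {z} = centralizer (generate G {z})"
  proof -
    have "y \<otimes> x = x \<otimes> y" if y: "y \<in> centralizer {z}" and x: "x \<in> generate G {z}" for x y
    proof -
      have yG: "y \<in> carrier G" and "y \<otimes> z = z \<otimes> y"
        using y unfolding centralizer_def by blast+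
      then have yz: "y \<otimes> z \<otimes> inv y = z"
        using commute_iff_conjugate_eq[OF yG z] by blast
      obtain i :: nat where i: "x = z [^] i"
        using x generate_singleton_eq_range[OF fin z] by blast
      have xG: "x \<in> carrier G" using i z by simp
      have "y \<otimes> x \<otimes> inv y = x"
        unfolding i conjugation_nat_pow[OF yG z] yz ..
      then show ?thesis
        using commute_iff_conjugate_eq[OF yG xG] by blast
    qed
    moreover have "z \<in> generate G {z}" by (rule generate.incl) simp
    ultimately show ?thesis unfolding centralizer_def by blast
  qed
  then have "characteristic_subgroup (centralizer {z}) G"
    using characteristic_centralizer[OF fin char] by simp
  moreover have "C \<subseteq> centralizer {z}"
  proof -
    have "z \<in> C" using tors generate.incl[of z "{z}" G] by blast
    then show ?thesis
      using comm characteristic_subgroup_imp_subgroup[OF characteristic_C, THEN subgroup.subset]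
      unfolding centralizer_def by blast
  qed
  moreover have "centralizer {z} \<noteq> carrier G"
    using neq g unfolding centralizer_def z_def by blast
  ultimately have "centralizer {z} = C"
    using characteristic_above_C by blast
  then show thesis
    using that z prime char by blast
qed

text \<open>The exponent \<open>r\<close> together with the faithful action on
  \<open>generate G {z}\<close> bounds the number of cosets by \<open>r\<close>; a coset of order
  \<open>r\<close> shows that \<open>r\<close> divides this number.\<close>

lemma exists_prime_index:
  obtains r x c where "Factorial_Ring.prime r" "x \<in> carrier G" "x \<notin> C" "c \<in> carrier G"
    "C = generate G {c}" "order G = r * ord c" "\<And>y. y \<in> carrier G \<Longrightarrow> y [^] (r::nat) \<in> C"
proof -
  obtain r x where r: "Factorial_Ring.prime r" and x: "x \<in> carrier G" "x \<notin> C"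
      and pow: "\<And>y. y \<in> carrier G \<Longrightarrow> y [^] (r::nat) \<in> C"
    using exists_prime_exponent_mod_C by blast
  obtain c where c: "c \<in> carrier G" "C = generate G {c}"
    using characteristic_subgroup_generator[OF characteristic_C C_proper] .
  obtain z where z: "z \<in> carrier G" "Factorial_Ring.prime (ord z)"
      "characteristic_subgroup (generate G {z}) G" "centralizer {z} = C"
    using exists_centralizer_eq_C[OF c] .
  have le: "card (rcosets C) \<le> r"
    using card_rcosets_centralizer_le[OF fin z(1,2) characteristic_subgroup_imp_normal[OF z(3)], of r]
      pow prime_gt_0_nat[OF r] unfolding z(4) by blast
  have nC: "C \<lhd> G" using characteristic_subgroup_imp_normal[OF characteristic_C] .
  interpret C: normal C G by (rule nC)
  interpret Q: group "G Mod C" by (rule C.factorgroup_is_group)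
  have V: "C #> x \<in> carrier (G Mod C)"
    using x(1) by (auto simp: FactGroup_def RCOSETS_def)
  have "Q.ord (C #> x) dvd r"
    using Q.pow_eq_id[OF V, of r] FactGroup_pow_eq_one_iff[OF nC x(1), of r] pow[OF x(1)] by blast
  moreover have "Q.ord (C #> x) \<noteq> 1"
  proof
    assume "Q.ord (C #> x) = 1"
    then have "(C #> x) [^]\<^bsub>G Mod C\<^esub> (1::nat) = \<one>\<^bsub>G Mod C\<^esub>"
      using Q.pow_eq_id[OF V, of 1] by (simp del: mult_FactGroup one_FactGroup)
    then show False
      using FactGroup_pow_eq_one_iff[OF nC x(1), of 1] x by simp
  qed
  ultimately have "Q.ord (C #> x) = r"
    using r by (metis prime_nat_iff)
  then have dvd: "r dvd card (rcosets C)"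
    using Q.ord_dvd_group_order[OF V] by (simp add: order_def FactGroup_def)
  have lag: "card (rcosets C) * card C = order G"
    by (rule lagrange[OF C.subgroup_axioms])
  have "0 < order G" using fin order_gt_0_iff_finite by blast
  then have "0 < card (rcosets C)" using lag by (metis mult_eq_0_iff not_gr_zero)
  then have "card (rcosets C) = r"
    using le dvd dvd_imp_le by (metis le_antisym)
  moreover have "card C = ord c"
    using generate_pow_card[OF c(1)] c(2) by simp
  ultimately have "order G = r * ord c" using lag by simp
  then show thesis
    using that r x c pow by blast
qed

end

text \<open>A group that is cyclic modulo a central part is commutative. Here \<open>E\<close> is
  central only modulo \<open>N\<close>, and the powers of \<open>x\<close> supply the cyclic
  part.\<close>

lemma (in group) comm_FactGroup_if_central_extension:
  assumes N: "N \<lhd> G" and x: "x \<in> carrier G"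
    and decomp: "\<And>y. y \<in> carrier G \<Longrightarrow> \<exists>e\<in>E. \<exists>k::nat. y = e \<otimes> x [^] k"
    and E: "E \<subseteq> carrier G"
    and central: "\<And>e g. e \<in> E \<Longrightarrow> g \<in> carrier G \<Longrightarrow> \<exists>w\<in>N. g \<otimes> e = w \<otimes> (e \<otimes> g)"
  shows "comm_group (G Mod N)"
proof -
  interpret N: normal N G by (rule N)
  interpret Q: group "G Mod N" by (rule N.factorgroup_is_group)
  let ?h = "\<lambda>y. N #> y"
  have mult: "?h (a \<otimes> b) = ?h a \<otimes>\<^bsub>G Mod N\<^esub> ?h b" if "a \<in> carrier G" "b \<in> carrier G" for a b
    using that by (simp add: N.rcos_sum)
  have cl: "?h a \<in> carrier (G Mod N)" if "a \<in> carrier G" for a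
    using that by (auto simp: FactGroup_def RCOSETS_def)
  have comm: "?h g \<otimes>\<^bsub>G Mod N\<^esub> ?h e = ?h e \<otimes>\<^bsub>G Mod N\<^esub> ?h g"
    if e: "e \<in> E" and g: "g \<in> carrier G" for e g
  proof -
    have eG: "e \<in> carrier G" using e E by blast
    obtain w where w: "w \<in> N" "g \<otimes> e = w \<otimes> (e \<otimes> g)"
      using central[OF e g] by blast
    have "?h (w \<otimes> (e \<otimes> g)) = ?h w #> (e \<otimes> g)"
      using w(1) eG g N.subset by (intro coset_mult_assoc[symmetric]) auto
    also have "?h w = N"
      using w(1) N.rcos_const[OF is_group] by blast
    finally show ?thesis
      using mult[OF g eG] mult[OF eG g] w(2) by simp
  qed
  show ?thesis
  proof (rule Q.group_comm_groupI)
    fix u v assume "u \<in> carrier (G Mod N)" "v \<in> carrier (G Mod N)"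
    then obtain y z where yz: "y \<in> carrier G" "z \<in> carrier G" and uv: "u = ?h y" "v = ?h z"
      by (auto simp: FactGroup_def RCOSETS_def)
    obtain e i where e: "e \<in> E" and y: "y = e \<otimes> x [^] (i::nat)"
      using decomp[OF yz(1)] by blast
    obtain f j where f: "f \<in> E" and z: "z = f \<otimes> x [^] (j::nat)"
      using decomp[OF yz(2)] by blast
    have G: "e \<in> carrier G" "f \<in> carrier G" "x [^] i \<in> carrier G" "x [^] j \<in> carrier G"
      using e f E x by auto
    have xx: "?h (x [^] i) \<otimes>\<^bsub>G Mod N\<^esub> ?h (x [^] j) = ?h (x [^] j) \<otimes>\<^bsub>G Mod N\<^esub> ?h (x [^] i)"
      using mult[OF G(3,4)] mult[OF G(4,3)] x by (simp only: nat_pow_mult add.commute)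
    have "u \<otimes>\<^bsub>G Mod N\<^esub> v = ?h e \<otimes>\<^bsub>G Mod N\<^esub> (?h (x [^] i) \<otimes>\<^bsub>G Mod N\<^esub> ?h f) \<otimes>\<^bsub>G Mod N\<^esub> ?h (x [^] j)"
      unfolding uv y z using G by (simp only: mult cl Q.m_assoc Q.m_closed m_closed)
    also have "\<dots> = (?h e \<otimes>\<^bsub>G Mod N\<^esub> ?h f) \<otimes>\<^bsub>G Mod N\<^esub> (?h (x [^] i) \<otimes>\<^bsub>G Mod N\<^esub> ?h (x [^] j))"
      unfolding comm[OF f G(3)] using G by (simp only: cl Q.m_assoc Q.m_closed)
    also have "\<dots> = (?h f \<otimes>\<^bsub>G Mod N\<^esub> ?h e) \<otimes>\<^bsub>G Mod N\<^esub> (?h (x [^] j) \<otimes>\<^bsub>G Mod N\<^esub> ?h (x [^] i))"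
      unfolding xx comm[OF f G(1)] ..
    also have "\<dots> = ?h f \<otimes>\<^bsub>G Mod N\<^esub> (?h e \<otimes>\<^bsub>G Mod N\<^esub> ?h (x [^] j)) \<otimes>\<^bsub>G Mod N\<^esub> ?h (x [^] i)"
      using G by (simp only: cl Q.m_assoc Q.m_closed)
    also have "\<dots> = v \<otimes>\<^bsub>G Mod N\<^esub> u"
      unfolding comm[OF e G(4), symmetric] unfolding uv y z using G
      by (simp only: mult cl Q.m_assoc Q.m_closed m_closed)
    finally show "u \<otimes>\<^bsub>G Mod N\<^esub> v = v \<otimes>\<^bsub>G Mod N\<^esub> u" .
  qed
qed

context ccs_nonnilpotent_nonperfect
begin

text \<open>If the index \<open>r\<close> of \<open>C\<close> were not the least prime divisor \<open>p\<close> of the order, the Sylow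
  \<open>p\<close>-subgroup of \<open>C\<close> would be central in \<open>G\<close>, because \<open>r\<close> does not divide the order of its
  automorphism group. It would then have a characteristic complement, which is cyclic and not
  contained in \<open>C\<close>, and this would force \<open>C\<close> not to be self-centralizing.\<close>

lemma prime_index_least:
  assumes p: "Factorial_Ring.prime p" "p dvd order G"
    and least: "\<And>l. Factorial_Ring.prime l \<Longrightarrow> l dvd order G \<Longrightarrow> p \<le> l"
    and r: "Factorial_Ring.prime r" and x: "x \<in> carrier G" "x \<notin> C"
    and c: "c \<in> carrier G" "C = generate G {c}" and order: "order G = r * ord c"
    and pow: "\<And>y. y \<in> carrier G \<Longrightarrow> y [^] r \<in> C"
  shows "r = p"
proof (rule ccontr)
  assume "r \<noteq> p"
  have "p \<le> r" using least[OF r] order by simp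
  then have "p < r" using \<open>r \<noteq> p\<close> by simp
  have ndvd_r: "\<not> p dvd r"
    using primes_dvd_imp_eq[OF p(1) r] \<open>r \<noteq> p\<close> by blast
  have pos: "0 < ord c" using fin c(1) by (rule ord_pos)
  have "p dvd ord c"
    using p order ndvd_r by (metis prime_dvd_mult_iff)
  \<comment> \<open>Split \<open>ord c\<close> into its \<open>p\<close>-part \<open>P\<close> and
    the cofactor \<open>d\<close>: then \<open>c [^] d\<close> generates the Sylow
    \<open>p\<close>-subgroup of \<open>C\<close> and \<open>c [^] P\<close> its complement in
    \<open>C\<close>.\<close>
  obtain d where d: "ord c = p ^ multiplicity p (ord c) * d" "\<not> p dvd d"
    using multiplicity_decompose'[of "ord c" p] pos p(1) by (metis neq0_conv not_prime_unit)
  define P where "P = p ^ multiplicity p (ord c)"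
  have n: "ord c = P * d" using d(1) by (simp add: P_def)
  have pos': "0 < P" "0 < d" using pos n by auto
  have div: "ord c div P = d" "ord c div d = P" using n pos' by auto
  have "p dvd P"
    unfolding P_def using \<open>p dvd ord c\<close> p(1) pos
    by (metis dvd_power multiplicity_gt_zero_iff not_prime_unit neq0_conv)
  have "coprime P d"
    unfolding P_def using prime_imp_power_coprime[OF p(1) d(2)] by (simp add: coprime_commute)
  have nC: "C \<lhd> G" using characteristic_subgroup_imp_normal[OF characteristic_C] .
  then have nc: "generate G {c} \<lhd> G" using c(2) by simp
  interpret C: normal C G by (rule nC)
  have comm: "y \<otimes> z = z \<otimes> y" if "y \<in> C" "z \<in> C" for y z
    using cyclic_subgroup_commute[OF c(1)] that c(2) by blast
  have cC: "c \<in> C" unfolding c(2) by (rule generate.incl) simp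
  \<comment> \<open>Since \<open>g [^] r\<close> lies in the abelian group \<open>C\<close>, the
    exponent satisfies \<open>u ^ r = 1\<close> modulo \<open>ord c\<close>. As \<open>r\<close> is
    a prime above \<open>p\<close>, \<open>cong_1_if_pow_cong_1\<close> gives \<open>u = 1\<close>
    modulo \<open>P\<close>.\<close>
  have act: "\<exists>t. g \<otimes> c \<otimes> inv g = c [^] (1 + P * t)" if g: "g \<in> carrier G" for g
  proof -
    obtain u0 :: nat where u0: "g \<otimes> c \<otimes> inv g = c [^] u0"
      by (rule conjugate_in_cyclic_normal[OF fin c(1) nc g])
    define u where "u = u0 + ord c"
    have "c [^] u0 = c [^] u"
      unfolding nat_pow_eq_iff_cong[OF c(1)] u_def by (simp add: cong_def)
    then have u: "g \<otimes> c \<otimes> inv g = c [^] u"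
      using u0 by simp
    have gr: "g [^] r \<in> carrier G" using g by simp
    have "g [^] r \<otimes> c = c \<otimes> g [^] r"
      using comm[OF pow[OF g] cC] .
    then have "g [^] r \<otimes> c \<otimes> inv (g [^] r) = c"
      using commute_iff_conjugate_eq[OF gr c(1)] by blast
    then have "c [^] (u ^ r) = c [^] (1::nat)"
      unfolding conjugation_nat_pow_iterate[OF g c(1) u] using c(1) by simp
    then have "[u ^ r = 1] (mod ord c)"
      unfolding nat_pow_eq_iff_cong[OF c(1)] .
    then have "[u ^ r = 1] (mod P)"
      unfolding n by (rule cong_modulus_mult_nat)
    moreover have "p < l" if "Factorial_Ring.prime l" "l dvd r" for l
      using primes_dvd_imp_eq[OF that(1) r that(2)] \<open>p < r\<close> by simp
    ultimately have "[u = 1] (mod P)"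
      using cong_1_if_pow_cong_1[OF p(1)] unfolding P_def by blast
    then have "P dvd u - 1"
      by (rule cong_to_1_nat)
    then obtain t where "u - 1 = P * t" by auto
    then have "u = 1 + P * t"
      using pos u_def by simp
    then show ?thesis using u by auto
  qed
  have central: "g \<otimes> c [^] d = c [^] d \<otimes> g" if g: "g \<in> carrier G" for g
  proof -
    obtain t where t: "g \<otimes> c \<otimes> inv g = c [^] (1 + P * t)"
      using act[OF g] by blast
    have "g \<otimes> c [^] d \<otimes> inv g = c [^] ((1 + P * t) * d)"
      unfolding conjugation_nat_pow[OF g c(1)] t using c(1) by (simp only: nat_pow_pow)
    also have "(1 + P * t) * d = d + t * (P * d)" by (simp add: algebra_simps)
    also have "c [^] \<dots> = c [^] d"
      unfolding nat_pow_eq_iff_cong[OF c(1)] n by (simp only: cong_def mod_mult_self1)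
    finally show ?thesis
      using commute_iff_conjugate_eq[OF g] c(1) by simp
  qed
  define D where "D = {y \<in> C. y [^] d = \<one>}"
  have characteristic_D: "characteristic_subgroup D G"
    unfolding D_def by (rule characteristic_torsion[OF fin characteristic_C comm])
  have nD: "D \<lhd> G" using characteristic_subgroup_imp_normal[OF characteristic_D] .
  have powD: "c [^] (P * j) \<in> D" for j
    unfolding D_def using subgroup_nat_pow_closed[OF C.subgroup_axioms cC] c(1)
    by (simp add: nat_pow_pow pow_eq_id n)
  \<comment> \<open>Modulo \<open>D\<close> the element \<open>c\<close> becomes central by
    \<open>act\<close>, and \<open>G Mod C\<close> is cyclic of order \<open>r\<close>.\<close>
  have "comm_group (G Mod D)"
  proof (rule comm_FactGroup_if_central_extension[OF nD x(1), where E = C])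
    fix y assume y: "y \<in> carrier G"
    have "order G = r * card C"
      using generate_pow_card[OF c(1)] c(2) order by simp
    then obtain k :: nat where "C #> y = C #> x [^] k"
      using FactGroup_prime_order_coset(2)[OF nC fin r _ x y] by blast
    moreover have "y \<in> C #> y" using rcos_self[OF y C.subgroup_axioms] .
    ultimately have "y \<in> C #> x [^] k" by simp
    then show "\<exists>e\<in>C. \<exists>k::nat. y = e \<otimes> x [^] k"
      unfolding r_coset_def by blast
  next
    fix e g assume e: "e \<in> C" and g: "g \<in> carrier G"
    obtain i :: nat where i: "e = c [^] i"
      using e c(2) generate_singleton_eq_range[OF fin c(1)] by blast
    have eG: "e \<in> carrier G" using e C.subset by blast
    obtain t where t: "g \<otimes> c \<otimes> inv g = c [^] (1 + P * t)"
      using act[OF g] by blast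
    have "g \<otimes> e \<otimes> inv g = c [^] ((1 + P * t) * i)"
      unfolding i conjugation_nat_pow[OF g c(1)] t using c(1) by (simp only: nat_pow_pow)
    also have "(1 + P * t) * i = P * (t * i) + i" by (simp add: algebra_simps)
    also have "c [^] \<dots> = c [^] (P * (t * i)) \<otimes> e"
      unfolding i using c(1) by (simp only: nat_pow_mult)
    finally have "g \<otimes> e \<otimes> inv g \<otimes> g = c [^] (P * (t * i)) \<otimes> e \<otimes> g" by simp
    then have "g \<otimes> e = c [^] (P * (t * i)) \<otimes> (e \<otimes> g)"
      using eG g c(1) by (simp add: m_assoc)
    then show "\<exists>w\<in>D. g \<otimes> e = w \<otimes> (e \<otimes> g)"
      using powD by blast
  qed (rule C.subset)
  then have characteristic_H: "characteristic_subgroup {y \<in> carrier G. y [^] r \<in> D} G"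
    by (rule characteristic_preimage_torsion[OF fin characteristic_D])
  \<comment> \<open>If this preimage of the \<open>r\<close>-torsion of \<open>G Mod D\<close>
    contained \<open>c [^] d\<close>, then \<open>p\<close> would divide \<open>d * r\<close>. So
    \<open>H\<close> is proper, hence cyclic.\<close>
  define H where "H = {y \<in> carrier G. y [^] r \<in> D}"
  have "c [^] d \<notin> H"
  proof
    assume "c [^] d \<in> H"
    then have "((c [^] d) [^] r) [^] d = \<one>"
      unfolding H_def D_def by blast
    then have "P * d dvd d * r * d"
      using c(1) by (simp add: nat_pow_pow pow_eq_id n)
    then have "P dvd d * r"
      using pos' by simp
    then have "p dvd d * r"
      using \<open>p dvd P\<close> dvd_trans by blast
    then show False
      using p(1) d(2) ndvd_r by (simp add: prime_dvd_mult_iff)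
  qed
  then have "H \<noteq> carrier G" using c(1) by auto
  then obtain h0 where h0: "h0 \<in> carrier G" "H = generate G {h0}"
    using characteristic_subgroup_generator[OF characteristic_H] unfolding H_def by blast
  \<comment> \<open>As \<open>x [^] r\<close> is a power of \<open>c\<close>, its
    \<open>P\<close>-th power falls into \<open>D\<close>, so \<open>h\<close> is in
    \<open>H\<close>. It commutes with \<open>c [^] P\<close> inside the cyclic \<open>H\<close> and
    with the central \<open>c [^] d\<close>, hence with \<open>c\<close>. This puts \<open>h\<close>
    into \<open>C\<close>, although \<open>r\<close> does not divide \<open>P\<close>.\<close>
  define h where "h = x [^] P"
  have hG: "h \<in> carrier G" using x(1) by (simp add: h_def)
  have "h \<in> H"
  proof -
    obtain i :: nat where i: "x [^] r = c [^] i"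
      using pow[OF x(1)] c(2) generate_singleton_eq_range[OF fin c(1)] by blast
    have "h [^] r = (x [^] r) [^] P"
      unfolding h_def using x(1) by (simp add: nat_pow_pow mult.commute)
    also have "\<dots> = c [^] (P * i)"
      unfolding i using c(1) by (simp add: nat_pow_pow mult.commute)
    finally show ?thesis
      unfolding H_def using powD hG by simp
  qed
  have "c [^] P \<in> H"
  proof -
    have "c [^] P \<in> D" using powD[of 1] by simp
    then have "(c [^] P) [^] r \<in> D"
      using subgroup_nat_pow_closed[OF characteristic_subgroup_imp_subgroup[OF characteristic_D]] by blast
    then show ?thesis unfolding H_def using c(1) by simp
  qed
  then have hP: "h \<otimes> c [^] P = c [^] P \<otimes> h"
    using cyclic_subgroup_commute[OF h0(1)] \<open>h \<in> H\<close> h0(2) by blast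
  obtain u :: nat where u: "h \<otimes> c \<otimes> inv h = c [^] u"
    by (rule conjugate_in_cyclic_normal[OF fin c(1) nc hG])
  have "[u = 1] (mod P)"
    using conjugation_cong_1[OF c(1) hG _ pos u, of P] central[OF hG] div n by simp
  moreover have "[u = 1] (mod d)"
    using conjugation_cong_1[OF c(1) hG _ pos u, of d] hP div n by simp
  ultimately have "[u = 1] (mod ord c)"
    unfolding n using \<open>coprime P d\<close> by (rule coprime_cong_mult_nat)
  then have "c [^] u = c [^] (1::nat)"
    unfolding nat_pow_eq_iff_cong[OF c(1)] .
  then have hc: "h \<otimes> c \<otimes> inv h = c" using u c(1) by simp
  have "h \<otimes> s = s \<otimes> h" if s: "s \<in> C" for s
  proof -
    obtain i :: nat where i: "s = c [^] i"
      using s c(2) generate_singleton_eq_range[OF fin c(1)] by blast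
    have sG: "s \<in> carrier G" using s C.subset by blast
    have "h \<otimes> s \<otimes> inv h = s"
      unfolding i conjugation_nat_pow[OF hG c(1)] hc ..
    then show ?thesis
      using commute_iff_conjugate_eq[OF hG sG] by blast
  qed
  then have "h \<in> C"
    using hG derived_subset_C unfolding C_def[symmetric] by (subst C_def) (auto simp: centralizer_def)
  then have "(C #> x) [^]\<^bsub>G Mod C\<^esub> P = \<one>\<^bsub>G Mod C\<^esub>"
    using FactGroup_pow_eq_one_iff[OF nC x(1)] unfolding h_def by blast
  moreover have "order G = r * card C"
    using generate_pow_card[OF c(1)] c(2) order by simp
  then have "group.ord (G Mod C) (C #> x) = r"
    using FactGroup_prime_order_coset(1)[OF nC fin r _ x] by blast
  moreover have "C #> x \<in> carrier (G Mod C)"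
    using x(1) by (auto simp: FactGroup_def RCOSETS_def)
  ultimately have "r dvd P"
    using group.pow_eq_id[OF C.factorgroup_is_group] by metis
  then have "r dvd p"
    unfolding P_def using r prime_dvd_power by blast
  then show False
    using primes_dvd_imp_eq[OF r p(1)] \<open>r \<noteq> p\<close> by blast
qed

lemma exists_characteristic_cyclic_index:
  assumes p: "Factorial_Ring.prime p" "p dvd order G"
    and least: "\<And>l. Factorial_Ring.prime l \<Longrightarrow> l dvd order G \<Longrightarrow> p \<le> l"
  obtains c where "c \<in> carrier G" "characteristic_subgroup (generate G {c}) G" "order G = p * ord c"
proof -
  obtain r x c where r: "Factorial_Ring.prime r" and x: "x \<in> carrier G" "x \<notin> C"
    and c: "c \<in> carrier G" "C = generate G {c}" and order: "order G = r * ord c"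
    and pow: "\<And>y. y \<in> carrier G \<Longrightarrow> y [^] (r::nat) \<in> C"
    using exists_prime_index by blast
  have "r = p"
    by (rule prime_index_least[OF p least r x c order pow])
  then show thesis
    using that[OF c(1)] characteristic_C c(2) order by simp
qed

end

section \<open>Endomorphisms of coprime order\<close>

context group
begin

lemma funpow_nat_pow:
  assumes "f \<in> hom G G" "c \<in> carrier G" "f c = c [^] (u::nat)"
  shows "(f ^^ k) c = c [^] (u ^ k)"
proof (induction k)
  case (Suc k)
  interpret f: group_hom G G f
    using assms(1) by unfold_locales
  show ?case
    using Suc assms f.hom_nat_pow[of c "u ^ k"] by (simp add: nat_pow_pow)
qed (use assms in simp)

lemma funpow_closed:
  assumes "f \<in> hom G G" "x \<in> carrier G"
  shows "(f ^^ k) x \<in> carrier G"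
  by (induction k) (use assms in \<open>auto simp: hom_def Pi_iff\<close>)

text \<open>On a cyclic group \<open>f\<close> is a power map, and its period forces the exponent to
  be 1 modulo \<open>p ^ b\<close> by \<open>cong_1_if_pow_cong_1\<close>. The displacement
  \<open>y [^] (p ^ b * t)\<close> is therefore \<open>m\<close>-torsion.\<close>

lemma coprime_endomorphism_trivial_on_cyclic:
  assumes fin: "finite (carrier G)" and f: "f \<in> hom G G"
    and c: "c \<in> carrier G" "f c \<in> generate G {c}"
    and p: "Factorial_Ring.prime p" and n: "ord c = p ^ b * m"
    and m: "\<And>l. Factorial_Ring.prime l \<Longrightarrow> l dvd m \<Longrightarrow> p < l"
    and period: "(f ^^ m) c = c"
  obtains t where "\<And>y. y \<in> generate G {c} \<Longrightarrow> f y = y [^] (p ^ b * t) \<otimes> y"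
proof -
  have pos: "0 < ord c" using fin c(1) by (rule ord_pos)
  obtain u0 :: nat where u0: "f c = c [^] u0"
    using c generate_singleton_eq_range[OF fin c(1)] by blast
  define u where "u = u0 + ord c"
  have "c [^] u0 = c [^] u"
    unfolding nat_pow_eq_iff_cong[OF c(1)] u_def by (simp add: cong_def)
  then have u: "f c = c [^] u"
    using u0 by simp
  have "c [^] (u ^ m) = c [^] (1::nat)"
    using funpow_nat_pow[OF f c(1) u, of m] period c(1) by simp
  then have "[u ^ m = 1] (mod ord c)"
    unfolding nat_pow_eq_iff_cong[OF c(1)] .
  then have "[u ^ m = 1] (mod p ^ b)"
    unfolding n by (rule cong_modulus_mult_nat)
  then have "[u = 1] (mod p ^ b)"
    using cong_1_if_pow_cong_1[OF p m] by blast
  then have "p ^ b dvd u - 1"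
    by (rule cong_to_1_nat)
  then obtain t where "u - 1 = p ^ b * t" by auto
  then have ut: "u = p ^ b * t + 1"
    using pos u_def by simp
  have "f y = y [^] (p ^ b * t) \<otimes> y" if y: "y \<in> generate G {c}" for y
  proof -
    have "y \<in> carrier G"
      using y generate_in_carrier[of "{c}"] c(1) by blast
    then show ?thesis
      using generate_singleton_pow_hom[OF fin c(1) f u y] unfolding ut by simp
  qed
  then show thesis using that by blast
qed

text \<open>The same argument one level up: on the quotient of order \<open>p\<close>,
  \<open>f\<close> raises the coset of \<open>x\<close> to some power \<open>v\<close>, and
  \<open>v ^ m = 1\<close> modulo \<open>p\<close> forces \<open>v = 1\<close>.\<close>

lemma coprime_endomorphism_trivial_mod_prime_index:
  assumes fin: "finite (carrier G)" and f: "f \<in> hom G G"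
    and C: "C \<lhd> G" "\<And>y. y \<in> C \<Longrightarrow> f y \<in> C"
    and p: "Factorial_Ring.prime p" and index: "order G = p * card C"
    and m: "\<And>l. Factorial_Ring.prime l \<Longrightarrow> l dvd m \<Longrightarrow> p < l"
    and x: "x \<in> carrier G" and period: "(f ^^ m) x = x"
  shows "\<exists>e\<in>C. f x = e \<otimes> x"
proof -
  interpret C: normal C G by (rule C(1))
  interpret Q: group "G Mod C" by (rule C.factorgroup_is_group)
  interpret f: group_hom G G f
    using f by unfold_locales
  have fx: "f x \<in> carrier G" using x by simp
  show ?thesis
  proof (cases "x \<in> C")
    case True
    then have "f x \<otimes> inv x \<in> C" using C(2) by simp
    moreover have "f x = f x \<otimes> inv x \<otimes> x" using x fx by (simp add: m_assoc)
    ultimately show ?thesis by blast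
  next
    case False
    let ?V = "C #> x"
    have V: "?V \<in> carrier (G Mod C)"
      using x by (auto simp: FactGroup_def RCOSETS_def)
    have ordV: "Q.ord ?V = p"
      by (rule FactGroup_prime_order_coset(1)[OF C(1) fin p index x False])
    obtain v :: nat where v: "C #> f x = C #> x [^] v"
      using FactGroup_prime_order_coset(2)[OF C(1) fin p index x False fx] by blast
    have "C #> (f ^^ j) x = C #> x [^] (v ^ j)" for j
    proof (induction j)
      case (Suc j)
      let ?y = "(f ^^ j) x"
      have y: "?y \<in> carrier G" by (rule funpow_closed[OF f x])
      have "?y \<in> C #> x [^] (v ^ j)"
        using rcos_self[OF y C.subgroup_axioms] Suc by simp
      then obtain e where e: "e \<in> C" "?y = e \<otimes> x [^] (v ^ j)"
        unfolding r_coset_def by blast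
      have eG: "e \<in> carrier G" using e(1) C.subset by blast
      have "f ?y = f e \<otimes> f x [^] (v ^ j)"
        unfolding e(2) using eG x f.hom_nat_pow[OF x] by simp
      then have "C #> f ?y = (C #> f e) #> f x [^] (v ^ j)"
        using eG fx C.subset by (simp add: coset_mult_assoc)
      also have "C #> f e = C"
        using C.rcos_const[OF is_group C(2)[OF e(1)]] .
      also have "C #> f x [^] (v ^ j) = (C #> f x) [^]\<^bsub>G Mod C\<^esub> (v ^ j)"
        by (rule C.FactGroup_pow[OF fx, symmetric])
      also have "\<dots> = C #> (x [^] v) [^] (v ^ j)"
        unfolding v using x by (intro C.FactGroup_pow) simp
      finally show ?case
        using x by (simp add: nat_pow_pow)
    qed (use x in simp)
    then have "C #> x [^] (v ^ m) = C #> x [^] (1::nat)"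
      using period x by (metis nat_pow_eone)
    then have "?V [^]\<^bsub>G Mod C\<^esub> (v ^ m) = ?V [^]\<^bsub>G Mod C\<^esub> (1::nat)"
      unfolding C.FactGroup_pow[OF x] .
    then have "[v ^ m = 1] (mod p ^ 1)"
      unfolding Q.nat_pow_eq_iff_cong[OF V] ordV by simp
    then have "[v = 1] (mod p ^ 1)"
      using cong_1_if_pow_cong_1[OF p m] by blast
    then have "?V [^]\<^bsub>G Mod C\<^esub> v = ?V [^]\<^bsub>G Mod C\<^esub> (1::nat)"
      unfolding Q.nat_pow_eq_iff_cong[OF V] ordV by simp
    then have "C #> f x = C #> x"
      unfolding C.FactGroup_pow[OF x] v[symmetric] using x by simp
    then have "f x \<in> C #> x"
      using rcos_self[OF fx C.subgroup_axioms] by simp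
    then show ?thesis
      unfolding r_coset_def by blast
  qed
qed

text \<open>\<open>f\<close> is trivial on \<open>generate G {c}\<close> modulo
  \<open>m\<close>-torsion and on \<open>G\<close> modulo \<open>generate G {c}\<close>. A coprime
  period allows no shear between these layers: iterating \<open>f x = e \<otimes> x\<close>
  accumulates powers of \<open>e\<close>, and returning to \<open>x\<close> makes \<open>e\<close>
  itself \<open>m\<close>-torsion.\<close>

lemma coprime_endomorphism_trivial_mod_torsion:
  assumes fin: "finite (carrier G)" and f: "f \<in> hom G G"
    and c: "c \<in> carrier G" "f c \<in> generate G {c}" and normal: "generate G {c} \<lhd> G"
    and p: "Factorial_Ring.prime p" and order: "order G = p * ord c" and n: "ord c = p ^ b * m"
    and m: "\<And>l. Factorial_Ring.prime l \<Longrightarrow> l dvd m \<Longrightarrow> p < l"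
    and period: "\<And>y. y \<in> carrier G \<Longrightarrow> (f ^^ m) y = y" and x: "x \<in> carrier G"
  shows "\<exists>a\<in>generate G {c}. a [^] m = \<one> \<and> f x = a \<otimes> x"
proof -
  let ?C = "generate G {c}"
  interpret C: normal ?C G by (rule normal)
  interpret f: group_hom G G f
    using f by unfold_locales
  have comm: "y \<otimes> z = z \<otimes> y" if "y \<in> ?C" "z \<in> ?C" for y z
    using cyclic_subgroup_commute[OF c(1)] that by blast
  have pow_closed: "y [^] (k::nat) \<in> ?C" if "y \<in> ?C" for y k
    using subgroup_nat_pow_closed[OF C.subgroup_axioms that] .
  obtain t where t: "\<And>y. y \<in> ?C \<Longrightarrow> f y = y [^] (p ^ b * t) \<otimes> y"
    using coprime_endomorphism_trivial_on_cyclic[OF fin f c p n m period[OF c(1)]] by blast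
  have fC: "f y \<in> ?C" if "y \<in> ?C" for y
    unfolding t[OF that] using pow_closed that by simp
  have "order G = p * card ?C"
    using order generate_pow_card[OF c(1)] by simp
  from coprime_endomorphism_trivial_mod_prime_index[OF fin f normal fC p this m x period[OF x]]
  obtain e where e: "e \<in> ?C" "f x = e \<otimes> x" by blast
  have eG: "e \<in> carrier G" using e(1) C.subset by blast
  have ord_dvd: "ord y dvd p ^ b * m" if "y \<in> ?C" for y
    using ord_dvd_card_subgroup[OF C.subgroup_axioms that] generate_pow_card[OF c(1)] n by simp
  have kill: "(y [^] (p ^ b * t)) [^] m = \<one>" if "y \<in> ?C" for y
  proof -
    have "y \<in> carrier G" using that C.subset by blast
    moreover have "p ^ b * m dvd p ^ b * t * m" by (simp add: mult.assoc)
    ultimately show ?thesis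
      using ord_dvd[OF that] by (simp add: nat_pow_pow pow_eq_id dvd_trans)
  qed
  \<comment> \<open>Applying \<open>f\<close> once more changes \<open>a \<otimes> e [^] j\<close>
    only by \<open>m\<close>-torsion, which the new \<open>a\<close> absorbs, and contributes one
    further factor \<open>e\<close>.\<close>
  have "\<exists>a\<in>?C. a [^] m = \<one> \<and> (f ^^ j) x = a \<otimes> e [^] j \<otimes> x" for j
  proof (induction j)
    case 0
    then show ?case using x by (intro bexI[of _ \<one>]) auto
  next
    case (Suc j)
    then obtain a where a: "a \<in> ?C" "a [^] m = \<one>" "(f ^^ j) x = a \<otimes> e [^] j \<otimes> x" by blast
    define w where "w = a \<otimes> e [^] j"
    define a' where "a' = w [^] (p ^ b * t) \<otimes> a"
    have w: "w \<in> ?C" unfolding w_def using a(1) pow_closed[OF e(1)] by simp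
    have G: "a \<in> carrier G" "w \<in> carrier G" "w [^] (p ^ b * t) \<in> carrier G"
      using a(1) w C.subset by auto
    have "(f ^^ Suc j) x = w [^] (p ^ b * t) \<otimes> w \<otimes> (e \<otimes> x)"
      using a(3) t[OF w] e(2) G x by (simp flip: w_def)
    also have "\<dots> = a' \<otimes> e [^] Suc j \<otimes> x"
      unfolding a'_def w_def[symmetric] using G eG x by (simp add: m_assoc w_def)
    finally have "(f ^^ Suc j) x = a' \<otimes> e [^] Suc j \<otimes> x" .
    moreover have "a' \<in> ?C" unfolding a'_def using a(1) pow_closed[OF w] by simp
    moreover have "a' [^] m = \<one>"
      unfolding a'_def
      using pow_mult_distrib[OF comm[OF pow_closed[OF w] a(1)] G(3,1), of m] kill[OF w] a(2) by simp
    ultimately show ?case by blast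
  qed
  from this[of m] obtain a where a: "a \<in> ?C" "a [^] m = \<one>" "x = a \<otimes> e [^] m \<otimes> x"
    unfolding period[OF x] by blast
  have aG: "a \<in> carrier G" using a(1) C.subset by blast
  have "a \<otimes> e [^] m = \<one>"
    using a(3) aG eG x by (metis m_closed nat_pow_closed r_cancel_one')
  then have "e [^] m = inv a"
    using aG eG by (metis inv_equality inv_inv nat_pow_closed inv_closed inv_comm)
  then have "(e [^] m) [^] m = \<one>"
    using a(2) aG by (simp add: nat_pow_inv)
  then have "ord e dvd m * m"
    using eG by (simp add: nat_pow_pow pow_eq_id)
  moreover have "ord e dvd p ^ b * m" using ord_dvd[OF e(1)] .
  \<comment> \<open>Periodicity bounds \<open>ord e\<close> only by \<open>m * m\<close>; the order
    of \<open>c\<close> removes the surplus factor \<open>m\<close>, since \<open>p\<close> does not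
    divide \<open>m\<close>.\<close>
  ultimately have "ord e dvd gcd (m * m) (p ^ b * m)" by simp
  moreover have "gcd (m * m) (p ^ b * m) = m"
  proof -
    have "\<not> p dvd m" using m[OF p] by blast
    then have "gcd m (p ^ b) = 1"
      using coprime_imp_gcd_eq_1[OF prime_imp_power_coprime[OF p], of m b] gcd.commute[of m "p ^ b"]
      by metis
    then show ?thesis
      using gcd_mult_distrib_nat[of m m "p ^ b"] by (simp add: mult.commute)
  qed
  ultimately have "e [^] m = \<one>"
    using eG by (simp add: pow_eq_id)
  then show ?thesis using e by blast
qed

end

section \<open>Finite skew braces\<close>

text \<open>A finite skew brace, presented by its additive group \<open>G\<close> (written multiplicatively), its
  multiplicative group \<open>M\<close> on the same carrier, and the action \<open>lam a b = - a + a \<cdot> b\<close> of \<open>M\<close>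
  on \<open>G\<close>.\<close>

locale brace_action = group G + M: group M
  for G :: "('a, 'b) monoid_scheme" (structure) and M :: "('a, 'c) monoid_scheme" +
  fixes lam :: "'a \<Rightarrow> 'a \<Rightarrow> 'a"
  assumes finite_carrier: "finite (carrier G)"
    and carrier_eq: "carrier M = carrier G"
    and mult_eq: "\<lbrakk>a \<in> carrier G; b \<in> carrier G\<rbrakk> \<Longrightarrow> a \<otimes>\<^bsub>M\<^esub> b = a \<otimes> lam a b"
    and lam_iso: "a \<in> carrier G \<Longrightarrow> lam a \<in> iso G G"
    and lam_mult: "\<lbrakk>a \<in> carrier G; b \<in> carrier G; z \<in> carrier G\<rbrakk>
      \<Longrightarrow> lam (a \<otimes>\<^bsub>M\<^esub> b) z = lam a (lam b z)"
begin

lemma lam_hom: "a \<in> carrier G \<Longrightarrow> lam a \<in> hom G G"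
  using lam_iso by (simp add: iso_def)

lemma lam_closed: "a \<in> carrier G \<Longrightarrow> z \<in> carrier G \<Longrightarrow> lam a z \<in> carrier G"
  using lam_hom by (auto simp: hom_def)

lemma lam_one_right: "a \<in> carrier G \<Longrightarrow> lam a \<one> = \<one>"
  using hom_one[OF lam_hom] is_group by blast

lemma lam_inj: "\<lbrakk>a \<in> carrier G; y \<in> carrier G; z \<in> carrier G; lam a y = lam a z\<rbrakk> \<Longrightarrow> y = z"
  using lam_iso[of a] by (auto simp: iso_def bij_betw_def dest: inj_onD)

text \<open>The multiplicative identity is idempotent, so its \<open>lam\<close> sends it to the
  additive identity; automorphisms are injective.\<close>

lemma one_eq: "\<one>\<^bsub>M\<^esub> = \<one>"
proof -
  have o: "\<one>\<^bsub>M\<^esub> \<in> carrier G" using M.one_closed carrier_eq by simp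
  have "\<one>\<^bsub>M\<^esub> \<otimes> lam \<one>\<^bsub>M\<^esub> \<one>\<^bsub>M\<^esub> = \<one>\<^bsub>M\<^esub>"
    using mult_eq[OF o o] by simp
  then have "lam \<one>\<^bsub>M\<^esub> \<one>\<^bsub>M\<^esub> = \<one>"
    using o lam_closed[OF o o] by simp
  then show ?thesis
    using lam_inj[OF o o one_closed] lam_one_right[OF o] by simp
qed

lemma lam_one:
  assumes z: "z \<in> carrier G"
  shows "lam \<one> z = z"
proof -
  have "\<one> \<otimes>\<^bsub>M\<^esub> \<one> = \<one>"
    using M.l_one[OF M.one_closed] unfolding one_eq .
  then have "lam \<one> z = lam \<one> (lam \<one> z)"
    using lam_mult[OF one_closed one_closed z] by simp
  then show ?thesis
    using lam_inj[OF one_closed z lam_closed[OF one_closed z]] by simp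
qed

lemma M_pow_closed: "a \<in> carrier G \<Longrightarrow> a [^]\<^bsub>M\<^esub> (k::nat) \<in> carrier G"
  using M.nat_pow_closed carrier_eq by simp

lemma lam_pow:
  assumes a: "a \<in> carrier G" and z: "z \<in> carrier G"
  shows "lam (a [^]\<^bsub>M\<^esub> k) z = (lam a ^^ k) z"
proof (induction k)
  case 0
  then show ?case using lam_one[OF z] by (simp add: one_eq)
next
  case (Suc k)
  have "a [^]\<^bsub>M\<^esub> Suc k = a \<otimes>\<^bsub>M\<^esub> a [^]\<^bsub>M\<^esub> k"
    using a carrier_eq by (intro M.nat_pow_Suc2) simp
  then show ?case
    using lam_mult[OF a M_pow_closed[OF a] z] Suc by simp
qed

text \<open>Products stay in \<open>H\<close> because \<open>lam a\<close> preserves it. For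
  inverses, the multiplicative inverse \<open>b\<close> of \<open>a\<close> solves
  \<open>lam a b = inv a\<close>, and \<open>lam a\<close> maps \<open>H\<close> onto
  \<open>H\<close>.\<close>

lemma characteristic_imp_subgroup_M:
  assumes H: "characteristic_subgroup H G"
  shows "subgroup H M"
proof -
  interpret H: subgroup H G
    using H by (rule characteristic_subgroup_imp_subgroup)
  show ?thesis
  proof (rule M.subgroupI)
    fix a b assume ab: "a \<in> H" "b \<in> H"
    have "lam a b \<in> H"
      using characteristic_subgroup_image[OF H lam_iso] ab by simp
    then show "a \<otimes>\<^bsub>M\<^esub> b \<in> H"
      using ab mult_eq[of a b] by simp
  next
    fix a assume a: "a \<in> H"
    let ?b = "inv\<^bsub>M\<^esub> a"
    have G: "a \<in> carrier G" "?b \<in> carrier G"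
      using a carrier_eq M.inv_closed by auto
    have "a \<otimes> lam a ?b = \<one>"
      using mult_eq[OF G] G carrier_eq M.r_inv[of a] by (simp add: one_eq)
    then have "lam a ?b = inv a"
      using G lam_closed[OF G] by (metis inv_equality inv_inv inv_closed inv_comm)
    then have "lam a ?b \<in> lam a ` H"
      using a H lam_iso[OF G(1)] unfolding characteristic_subgroup_def by auto
    then obtain h where h: "h \<in> H" "lam a ?b = lam a h" by blast
    then have "?b = h"
      using lam_inj[OF G] by simp
    then show "?b \<in> H" using h by simp
  qed (use H.subset carrier_eq in simp, use H.one_closed in blast)
qed

text \<open>If \<open>lam g g = g [^] u\<close>, then the \<open>k\<close>-th multiplicative power of \<open>g\<close> is the additive
  multiple of \<open>g\<close> by \<open>1 + u + \<dots> + u ^ (k - 1)\<close>, and \<open>u\<close> is congruent to \<open>1\<close> modulo \<open>p\<close>.\<close>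

lemma ord_M_eq_ord:
  assumes p: "Factorial_Ring.prime p" "2 < p" and g: "g \<in> carrier G" "ord g = p ^ k"
    and char: "characteristic_subgroup (generate G {g}) G"
  shows "M.ord g = p ^ k"
proof -
  have gM: "g \<in> carrier M" using g(1) carrier_eq by simp
  have gg: "g \<in> generate G {g}" by (rule generate.incl) simp
  have "M.ord g dvd card (generate G {g})"
    using M.ord_dvd_card_subgroup[OF characteristic_imp_subgroup_M[OF char] gg] .
  then have dvd: "M.ord g dvd p ^ k"
    using generate_pow_card[OF g(1)] g(2) by simp
  show ?thesis
  proof (cases k)
    case 0
    then show ?thesis using dvd by simp
  next
    case (Suc j)
    have "lam g g \<in> generate G {g}"
      using characteristic_subgroup_image[OF char lam_iso[OF g(1)] gg] .
    then obtain u :: nat where u: "lam g g = g [^] u"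
      using generate_singleton_eq_range[OF finite_carrier g(1)] by blast
    interpret lam: group_hom G G "lam g"
      using lam_hom[OF g(1)] by unfold_locales
    have pow: "g [^]\<^bsub>M\<^esub> i = g [^] (\<Sum>l<i. u ^ l)" for i
    proof (induction i)
      case (Suc i)
      have "g [^]\<^bsub>M\<^esub> Suc i = g \<otimes>\<^bsub>M\<^esub> g [^]\<^bsub>M\<^esub> i"
        using gM by (rule M.nat_pow_Suc2)
      also have "\<dots> = g \<otimes> lam g (g [^] (\<Sum>l<i. u ^ l))"
        using mult_eq[OF g(1) M_pow_closed[OF g(1)], of i] Suc by simp
      also have "\<dots> = g [^] (1::nat) \<otimes> g [^] (u * (\<Sum>l<i. u ^ l))"
        using g(1) u by (simp add: lam.hom_nat_pow nat_pow_pow)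
      also have "\<dots> = g [^] (1 + u * (\<Sum>l<i. u ^ l))"
        using g(1) by (rule nat_pow_mult)
      also have "1 + u * (\<Sum>l<i. u ^ l) = (\<Sum>l<Suc i. u ^ l)"
        by (simp only: sum.lessThan_Suc_shift sum_distrib_left) simp
      finally show ?case .
    qed (simp add: one_eq)
    \<comment> \<open>The multiplicative relation makes the \<open>p ^ k\<close>-fold iterate of
      \<open>lam g\<close> the identity, so \<open>u ^ p ^ k = 1\<close> modulo \<open>p\<close>. By
      Fermat, \<open>p\<close>-th powers do not change residues, whence \<open>u = 1\<close> modulo
      \<open>p\<close>.\<close>
    have "g [^]\<^bsub>M\<^esub> (p ^ k) = \<one>\<^bsub>M\<^esub>"
      using M.pow_eq_id[OF gM] dvd by blast
    then have "g [^] (u ^ p ^ k) = g [^] (1::nat)"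
      using lam_pow[OF g(1) g(1), of "p ^ k"] funpow_nat_pow[OF lam_hom[OF g(1)] g(1) u, of "p ^ k"]
        lam_one[OF g(1)] g(1) one_eq by simp
    then have "[u ^ p ^ k = 1] (mod p ^ k)"
      unfolding nat_pow_eq_iff_cong[OF g(1)] g(2) .
    then have "[u ^ p ^ k = 1] (mod p)"
      unfolding Suc power_Suc by (rule cong_modulus_mult_nat)
    moreover have "[u ^ p ^ i = u] (mod p)" for i
    proof (induction i)
      case (Suc i)
      have "[u ^ p ^ Suc i = (u ^ p ^ i) ^ p] (mod p)"
        by (simp only: power_Suc2 power_mult cong_refl)
      also have "[(u ^ p ^ i) ^ p = u ^ p] (mod p)"
        using Suc by (rule cong_pow)
      also have "[u ^ p = u] (mod p)"
      proof (cases "p dvd u")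
        case True
        moreover have "u dvd u ^ p" using p(2) by (intro dvd_power) simp
        ultimately have "p dvd u ^ p" by (rule dvd_trans)
        with True show ?thesis by (simp add: cong_def)
      next
        case False
        then have "[u ^ (p - 1) * u = 1 * u] (mod p)"
          using fermat_theorem[OF p(1)] by (intro cong_mult) auto
        moreover have "u ^ (p - 1) * u = u ^ p"
          using p(2) by (simp flip: power_Suc2)
        ultimately show ?thesis by simp
      qed
      finally show ?case .
    qed simp
    ultimately have u1: "[u = 1] (mod p)"
      using cong_sym cong_trans by blast
    show ?thesis
    \<comment> \<open>A smaller multiplicative order would divide \<open>p ^ j\<close>, and then
      \<open>ord g = p ^ Suc j\<close> would divide the geometric sum of \<open>p ^ j\<close>
      terms.\<close>
    proof (rule ccontr)
      assume "M.ord g \<noteq> p ^ k"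
      moreover obtain i where i: "i \<le> k" "M.ord g = p ^ i"
        using dvd divides_primepow_nat[OF p(1)] by blast
      ultimately have "i \<le> j" using Suc by (cases "i = k") auto
      then have "M.ord g dvd p ^ j" unfolding i(2) by (rule le_imp_power_dvd)
      then have "g [^]\<^bsub>M\<^esub> (p ^ j) = \<one>\<^bsub>M\<^esub>"
        using M.pow_eq_id[OF gM] by blast
      then have "p ^ Suc j dvd (\<Sum>l<p ^ j. u ^ l)"
        unfolding pow one_eq pow_eq_id[OF g(1)] g(2) Suc .
      then show False using not_dvd_geometric_sum[OF p u1] by blast
    qed
  qed
qed

lemma torsion_normal_M:
  assumes c: "c \<in> carrier G" and char: "characteristic_subgroup (generate G {c}) G"
    and p: "Factorial_Ring.prime p" and order: "order G = p * ord c" and n: "ord c = p ^ b * m"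
    and m: "\<And>l. Factorial_Ring.prime l \<Longrightarrow> l dvd m \<Longrightarrow> p < l"
  shows "{y \<in> generate G {c}. y [^] m = \<one>} \<lhd> M"
proof -
  define A where "A = {y \<in> generate G {c}. y [^] m = \<one>}"
  have charA: "characteristic_subgroup A G"
    unfolding A_def using characteristic_torsion[OF finite_carrier char cyclic_subgroup_commute[OF c]] .
  have normalA: "A \<lhd> G" using characteristic_subgroup_imp_normal[OF charA] .
  interpret A: normal A G by (rule normalA)
  have subM: "subgroup A M" by (rule characteristic_imp_subgroup_M[OF charA])
  have AG: "a \<in> carrier G" if "a \<in> A" for a using A.mem_carrier[OF that] .
  have cc: "c \<in> generate G {c}" by (rule generate.incl) simp
  have cardA: "card A = m"
    unfolding A_def using card_torsion_of_cyclic[OF finite_carrier c, of m] n by simp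
  \<comment> \<open>The multiplicative order of \<open>a\<close> divides \<open>m\<close>, so
    \<open>lam a\<close> has period \<open>m\<close> and moves \<open>x\<close> only within its
    coset of \<open>A\<close>.\<close>
  have move: "\<exists>a'\<in>A. a \<otimes>\<^bsub>M\<^esub> x = a' \<otimes> x" if a: "a \<in> A" and x: "x \<in> carrier G" for a x
  proof -
    have aM: "a \<in> carrier M" using AG[OF a] carrier_eq by simp
    have "a [^]\<^bsub>M\<^esub> m = \<one>\<^bsub>M\<^esub>"
      using M.ord_dvd_card_subgroup[OF subM a] M.pow_eq_id[OF aM] unfolding cardA by blast
    then have period: "(lam a ^^ m) y = y" if "y \<in> carrier G" for y
      using lam_pow[OF AG[OF a] that, of m] lam_one[OF that] one_eq by simp
    have "lam a c \<in> generate G {c}"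
      using characteristic_subgroup_image[OF char lam_iso[OF AG[OF a]] cc] .
    from coprime_endomorphism_trivial_mod_torsion[OF finite_carrier lam_hom[OF AG[OF a]] c this
        characteristic_subgroup_imp_normal[OF char] p order n m period x]
    obtain w where w: "w \<in> A" "lam a x = w \<otimes> x"
      unfolding A_def by blast
    have "a \<otimes>\<^bsub>M\<^esub> x = a \<otimes> w \<otimes> x"
      using mult_eq[OF AG[OF a] x] w(2) AG[OF a] AG[OF w(1)] x by (simp add: m_assoc)
    moreover have "a \<otimes> w \<in> A" using a w(1) by (rule A.m_closed)
    ultimately show ?thesis by blast
  qed
  have cosets: "(\<lambda>a. a \<otimes>\<^bsub>M\<^esub> x) ` A = (\<lambda>a. a \<otimes> x) ` A" if x: "x \<in> carrier G" for x
  proof (rule card_subset_eq)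
    show "finite ((\<lambda>a. a \<otimes> x) ` A)"
      by (rule finite_imageI[OF finite_subset[OF A.subset finite_carrier]])
    show "(\<lambda>a. a \<otimes>\<^bsub>M\<^esub> x) ` A \<subseteq> (\<lambda>a. a \<otimes> x) ` A"
    proof (rule image_subsetI)
      fix a assume "a \<in> A"
      from move[OF this x] show "a \<otimes>\<^bsub>M\<^esub> x \<in> (\<lambda>a. a \<otimes> x) ` A" by blast
    qed
    have "inj_on (\<lambda>a. a \<otimes>\<^bsub>M\<^esub> x) A"
    proof (rule inj_onI)
      fix a a' assume "a \<in> A" "a' \<in> A" "a \<otimes>\<^bsub>M\<^esub> x = a' \<otimes>\<^bsub>M\<^esub> x"
      then show "a = a'" using M.r_cancel[of a x a'] AG x carrier_eq by simp
    qed
    moreover have "inj_on (\<lambda>a. a \<otimes> x) A"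
    proof (rule inj_onI)
      fix a a' assume "a \<in> A" "a' \<in> A" "a \<otimes> x = a' \<otimes> x"
      then show "a = a'" using r_cancel[of a x a'] AG x by simp
    qed
    ultimately show "card ((\<lambda>a. a \<otimes>\<^bsub>M\<^esub> x) ` A) = card ((\<lambda>a. a \<otimes> x) ` A)"
      by (simp only: card_image)
  qed
  have conj: "x \<otimes>\<^bsub>M\<^esub> a \<otimes>\<^bsub>M\<^esub> inv\<^bsub>M\<^esub> x \<in> A" if x: "x \<in> carrier M" and a: "a \<in> A" for x a
  proof -
    have xG: "x \<in> carrier G" using x carrier_eq by simp
    have l: "lam x a \<in> A"
      using characteristic_subgroup_image[OF charA lam_iso[OF xG] a] .
    have "x \<otimes> lam x a = (x \<otimes> lam x a \<otimes> inv x) \<otimes> x"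
      using xG AG[OF l] by (simp add: m_assoc)
    moreover have "x \<otimes> lam x a \<otimes> inv x \<in> A"
      using A.inv_op_closed2[OF xG l] .
    ultimately have "x \<otimes>\<^bsub>M\<^esub> a \<in> (\<lambda>a. a \<otimes> x) ` A"
      using mult_eq[OF xG AG[OF a]] by simp
    then obtain a' where a': "a' \<in> A" "x \<otimes>\<^bsub>M\<^esub> a = a' \<otimes>\<^bsub>M\<^esub> x"
      using cosets[OF xG] by blast
    have a'M: "a' \<in> carrier M" using AG[OF a'(1)] carrier_eq by simp
    have "x \<otimes>\<^bsub>M\<^esub> a \<otimes>\<^bsub>M\<^esub> inv\<^bsub>M\<^esub> x = a'"
      unfolding a'(2) using x a'M by (simp add: M.m_assoc)
    then show ?thesis using a'(1) by simp
  qed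
  show ?thesis
    unfolding A_def[symmetric] using subM conj M.normal_inv_iff by blast
qed

end

section \<open>Sylow subgroups and nilpotency\<close>

context group
begin

text \<open>The inverse turns right multiplication into a left action; the restriction to
  \<open>rcosets S\<close> is there because elements of \<open>BijGroup\<close> are extensional
  functions.\<close>

lemma coset_group_action:
  assumes S: "subgroup S G" and U: "subgroup U G"
  shows "group_action (G\<lparr>carrier := U\<rparr>) (rcosets S) (\<lambda>h. \<lambda>T\<in>rcosets S. T #> inv h)"
proof -
  interpret S: subgroup S G by (rule S)
  interpret U: subgroup U G by (rule U)
  interpret UG: group "G\<lparr>carrier := U\<rparr>" using U by (rule subgroup_imp_group)
  have cl: "T #> h \<in> rcosets S" if "T \<in> rcosets S" "h \<in> carrier G" for T h
    using that by (auto simp: RCOSETS_def coset_mult_assoc[OF S.subset])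
  have mult: "T #> g #> h = T #> (g \<otimes> h)" if "T \<in> rcosets S" "g \<in> carrier G" "h \<in> carrier G" for T g h
    using coset_mult_assoc[OF S.rcosets_carrier[OF is_group that(1)] that(2,3)] .
  have one: "T #> \<one> = T" if "T \<in> rcosets S" for T
    using coset_mult_one[OF S.rcosets_carrier[OF is_group that]] .
  have bij: "(\<lambda>T\<in>rcosets S. T #> inv h) \<in> Bij (rcosets S)" if h: "h \<in> U" for h
  proof -
    have hG: "h \<in> carrier G" using U.mem_carrier[OF h] .
    have "bij_betw (\<lambda>T. T #> inv h) (rcosets S) (rcosets S)"
      by (rule bij_betw_byWitness[where f' = "\<lambda>T. T #> h"]) (use hG in \<open>auto simp: cl mult one\<close>)
    then show ?thesis
      by (simp add: Bij_def)
  qed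
  have "(\<lambda>h. \<lambda>T\<in>rcosets S. T #> inv h) \<in> hom (G\<lparr>carrier := U\<rparr>) (BijGroup (rcosets S))"
  proof (rule homI)
    fix g h assume "g \<in> carrier (G\<lparr>carrier := U\<rparr>)" "h \<in> carrier (G\<lparr>carrier := U\<rparr>)"
    then have gh: "g \<in> U" "h \<in> U" "g \<in> carrier G" "h \<in> carrier G"
      using U.mem_carrier by auto
    then show "(\<lambda>T\<in>rcosets S. T #> inv (g \<otimes>\<^bsub>G\<lparr>carrier := U\<rparr>\<^esub> h)) =
        (\<lambda>T\<in>rcosets S. T #> inv g) \<otimes>\<^bsub>BijGroup (rcosets S)\<^esub> (\<lambda>T\<in>rcosets S. T #> inv h)"
      by (auto simp: BijGroup_def bij compose_def cl mult inv_mult_group intro!: restrict_ext)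
  qed (simp add: BijGroup_def bij)
  then show ?thesis
    unfolding group_action_def group_hom_def group_hom_axioms_def
    using UG.is_group group_BijGroup by blast
qed

text \<open>The \<open>r\<close>-group generated by \<open>x\<close> acts on the cosets, whose
  number is prime to \<open>r\<close>, so some orbit is a single coset \<open>S #> g\<close>. Fixing
  it means that \<open>g\<close> conjugates \<open>x\<close> into \<open>S\<close>.\<close>

lemma conjugate_in_subgroup_of_coprime_index:
  assumes fin: "finite (carrier G)" and S: "subgroup S G" and r: "Factorial_Ring.prime r"
    and x: "x \<in> carrier G" "ord x = r ^ k" and index: "\<not> r dvd card (rcosets S)"
  shows "\<exists>g\<in>carrier G. g \<otimes> x \<otimes> inv g \<in> S"
proof -
  interpret S: subgroup S G by (rule S)
  define U where "U = generate G {x}"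
  have U: "subgroup U G" unfolding U_def by (rule subgroup_generate_singleton[OF x(1)])
  have xU: "x \<in> U" unfolding U_def by (rule generate.incl) simp
  let ?H = "G\<lparr>carrier := U\<rparr>" and ?E = "rcosets S" and ?act = "\<lambda>h. \<lambda>T\<in>rcosets S. T #> inv h"
  interpret act: group_action ?H ?E ?act
    by (rule coset_group_action[OF S U])
  have finE: "finite ?E"
    using fin by (simp add: RCOSETS_def)
  have orderH: "order ?H = r ^ k"
    using generate_pow_card[OF x(1)] x(2) by (simp add: order_def U_def)
  have "\<exists>T\<in>?E. card (orbit ?H ?act T) = 1"
  proof (rule ccontr)
    assume no: "\<not> ?thesis"
    have "r dvd card orb" if "orb \<in> orbits ?H ?E ?act" for orb
    proof -
      obtain T where T: "T \<in> ?E" "orb = orbit ?H ?act T"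
        using \<open>orb \<in> orbits ?H ?E ?act\<close> unfolding orbits_def by blast
      have "card orb dvd r ^ k"
        using act.orbit_stabilizer_theorem[OF T(1)] unfolding orderH T(2) by (metis dvd_triv_left)
      then obtain i where i: "card orb = r ^ i"
        using divides_primepow_nat[OF r] by blast
      moreover have "card orb \<noteq> 1" using no T by blast
      ultimately have "i \<noteq> 0" by (metis power_0)
      then show ?thesis unfolding i by simp
    qed
    then have "r dvd (\<Sum>orb\<in>orbits ?H ?E ?act. card orb)"
      by (rule dvd_sum)
    also have "\<dots> = card ?E"
      using act.disjoint_sum[OF finE, of "\<lambda>_. 1::nat"] by simp
    finally show False using index by simp
  qed
  then obtain T where T: "T \<in> ?E" "card (orbit ?H ?act T) = 1" by blast
  have "T \<in> orbit ?H ?act T" by (rule act.orbit_refl[OF T(1)])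
  moreover have "?act x T \<in> orbit ?H ?act T"
    unfolding orbit_def using xU by auto
  ultimately have "?act x T = T"
    using T(2) by (metis card_1_singletonE singletonD)
  then have fix_T: "T #> inv x = T" using T(1) by simp
  obtain g where g: "g \<in> carrier G" "T = S #> g"
    using T(1) by (auto simp: RCOSETS_def)
  have "S #> (g \<otimes> inv x) = S #> g"
    using fix_T g x(1) coset_mult_assoc[OF S.subset g(1), of "inv x"] by simp
  then have "g \<otimes> inv x \<in> S #> g"
    using rcos_self[of "g \<otimes> inv x", OF _ S] g x(1) by simp
  then obtain s where s: "s \<in> S" "g \<otimes> inv x = s \<otimes> g"
    unfolding r_coset_def by blast
  have sG: "s \<in> carrier G" using S.mem_carrier[OF s(1)] .
  have "g \<otimes> inv x \<otimes> inv g = s"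
    unfolding s(2) using g(1) sG by (simp add: m_assoc)
  then have "inv s = g \<otimes> x \<otimes> inv g"
    using g(1) x(1) by (auto simp: inv_mult_group m_assoc)
  then show ?thesis
    using g(1) S.m_inv_closed[OF s(1)] by metis
qed

lemma ord_conjugate:
  assumes "g \<in> carrier G" "x \<in> carrier G"
  shows "ord (g \<otimes> x \<otimes> inv g) = ord x"
proof -
  have G: "g \<otimes> x \<otimes> inv g \<in> carrier G" using assms by simp
  have one: "g \<otimes> z \<otimes> inv g = \<one> \<longleftrightarrow> z = \<one>" if z: "z \<in> carrier G" for z
  proof
    assume "g \<otimes> z \<otimes> inv g = \<one>"
    then have "g \<otimes> z \<otimes> inv g = g \<otimes> inv g" using assms(1) by simp
    then have "g \<otimes> z = g" using assms(1) z by (simp only: right_cancel m_closed inv_closed)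
    then show "z = \<one>" using assms(1) z by simp
  qed (use assms(1) in simp)
  have "(g \<otimes> x \<otimes> inv g) [^] n = \<one> \<longleftrightarrow> x [^] n = \<one>" for n :: nat
    unfolding conjugation_nat_pow[OF assms, symmetric] using one[OF nat_pow_closed[OF assms(2)]] .
  then have "ord (g \<otimes> x \<otimes> inv g) dvd n \<longleftrightarrow> ord x dvd n" for n
    unfolding pow_eq_id[OF G] pow_eq_id[OF assms(2)] .
  then show ?thesis
    by (meson dvd_antisym dvd_refl)
qed

lemma generate_eq_if_ord_eq_card:
  assumes "finite (carrier G)" "subgroup P G" "y \<in> P" "ord y = card P"
  shows "generate G {y} = P"
proof (rule card_subset_eq)
  have yG: "y \<in> carrier G" using subgroup.mem_carrier[OF assms(2,3)] .
  show "finite P" using finite_subset[OF subgroup.subset[OF assms(2)] assms(1)] .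
  show "generate G {y} \<subseteq> P" using generate_subgroup_incl[OF _ assms(2)] assms(3) by simp
  show "card (generate G {y}) = card P" using generate_pow_card[OF yG] assms(4) by simp
qed

text \<open>Any Sylow subgroup contains a conjugate of the given \<open>h\<close> and is generated
  by it, since the orders agree. For primes not dividing the order the identity serves as
  \<open>h\<close>.\<close>

lemma Z_groupI:
  assumes fin: "finite (carrier G)"
    and sylow: "\<And>r. Factorial_Ring.prime r \<Longrightarrow> \<exists>h\<in>carrier G. ord h = r ^ multiplicity r (order G)"
  shows "Z_group G"
  unfolding Z_group_def
proof (intro conjI allI impI)
  fix r P assume rP: "Factorial_Ring.prime r \<and> sylow_subgroup r P G"
  then have r: "Factorial_Ring.prime r" and P: "subgroup P G" "card P = r ^ multiplicity r (order G)"
    unfolding sylow_subgroup_def by auto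
  have pos: "order G \<noteq> 0" using fin order_gt_0_iff_finite by simp
  have "\<not> r dvd card (rcosets P)"
  proof
    assume "r dvd card (rcosets P)"
    then have "r * r ^ multiplicity r (order G) dvd card (rcosets P) * card P"
      unfolding P(2) by (rule mult_dvd_mono) simp
    then have "r ^ Suc (multiplicity r (order G)) dvd order G"
      using lagrange[OF P(1)] by simp
    then have "Suc (multiplicity r (order G)) \<le> multiplicity r (order G)"
      using pos r by (intro multiplicity_geI) auto
    then show False by simp
  qed
  moreover obtain h where h: "h \<in> carrier G" "ord h = r ^ multiplicity r (order G)"
    using sylow[OF r] by blast
  ultimately obtain g where g: "g \<in> carrier G" "g \<otimes> h \<otimes> inv g \<in> P"
    using conjugate_in_subgroup_of_coprime_index[OF fin P(1) r] by blast
  have "ord (g \<otimes> h \<otimes> inv g) = card P"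
    using ord_conjugate[OF g(1) h(1)] h(2) P(2) by simp
  then have "generate G {g \<otimes> h \<otimes> inv g} = P"
    using generate_eq_if_ord_eq_card[OF fin P(1) g(2)] by blast
  then show "cyclic_group (G\<lparr>carrier := P\<rparr>)"
    using cyclic_group_generate_singleton[of "g \<otimes> h \<otimes> inv g"] g(1) h(1) by simp
qed (use fin is_group in auto)

section \<open>Elements of coprime order, cyclicity and nilpotency\<close>

lemma ord_mult_coprime:
  assumes G: "x \<in> carrier G" "y \<in> carrier G" and comm: "x \<otimes> y = y \<otimes> x"
    and coprime: "coprime (ord x) (ord y)"
  shows "ord (x \<otimes> y) = ord x * ord y"
proof (rule dvd_antisym)
  show "ord (x \<otimes> y) dvd ord x * ord y" by (rule ord_mul_divides[OF comm G])
  have aux: "ord a dvd ord (a \<otimes> b)"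
    if ab: "a \<in> carrier G" "b \<in> carrier G" "a \<otimes> b = b \<otimes> a" "coprime (ord a) (ord b)" for a b
  proof -
    let ?k = "ord (a \<otimes> b) * ord b"
    have "(a \<otimes> b) [^] ?k = \<one>" using ab by (simp add: pow_eq_id)
    moreover have "b [^] ?k = \<one>" using ab by (simp add: pow_eq_id)
    ultimately have "a [^] ?k = \<one>"
      using pow_mult_distrib[OF ab(3,1,2), of ?k] ab(1) by simp
    then have "ord a dvd ord (a \<otimes> b) * ord b"
      using ab by (simp add: pow_eq_id)
    then show ?thesis using ab(4) coprime_dvd_mult_left_iff by blast
  qed
  have "ord x dvd ord (x \<otimes> y)" using aux[OF G comm coprime] .
  moreover have "ord y dvd ord (x \<otimes> y)"
    using aux[OF G(2,1) comm[symmetric]] coprime comm by (simp add: coprime_commute)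
  ultimately show "ord x * ord y dvd ord (x \<otimes> y)"
    using coprime by (simp add: divides_mult)
qed

text \<open>Elements chosen for different primes have coprime orders, so they commute and the order
  of their product is the product of the orders.\<close>

lemma cyclic_if_sylow_cyclic_and_coprime_commute:
  assumes fin: "finite (carrier G)"
    and sylow: "\<And>r. Factorial_Ring.prime r \<Longrightarrow> \<exists>h\<in>carrier G. ord h = r ^ multiplicity r (order G)"
    and comm: "\<And>x y. x \<in> carrier G \<Longrightarrow> y \<in> carrier G \<Longrightarrow> coprime (ord x) (ord y) \<Longrightarrow> x \<otimes> y = y \<otimes> x"
  obtains a where "a \<in> carrier G" "ord a = order G"
proof -
  let ?v = "\<lambda>r. r ^ multiplicity r (order G)"
  have "\<exists>a\<in>carrier G. ord a = (\<Prod>r\<in>R. ?v r)" if "finite R" "R \<subseteq> prime_factors (order G)" for R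
    using that
  proof (induction R rule: finite_induct)
    case empty
    then show ?case by (intro bexI[of _ \<one>]) auto
  next
    case (insert s R)
    then obtain a where a: "a \<in> carrier G" "ord a = (\<Prod>r\<in>R. ?v r)" by auto
    have s: "Factorial_Ring.prime s" using insert.prems by auto
    obtain h where h: "h \<in> carrier G" "ord h = ?v s" using sylow[OF s] by blast
    have "coprime (ord h) (ord a)"
      unfolding a(2) h(2)
    proof (rule prod_coprime_right)
      fix r assume r: "r \<in> R"
      then have "Factorial_Ring.prime r" "s \<noteq> r" using insert by auto
      then show "coprime (?v s) (?v r)"
        using primes_coprime_nat[OF s, of r] by simp
    qed
    then have "ord (h \<otimes> a) = ?v s * (\<Prod>r\<in>R. ?v r)"
      using ord_mult_coprime[OF h(1) a(1) comm[OF h(1) a(1)]] a(2) h(2) by simp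
    then show ?case
      using insert h(1) a(1) by (intro bexI[of _ "h \<otimes> a"]) auto
  qed
  from this[of "prime_factors (order G)"] obtain a where
    "a \<in> carrier G" "ord a = (\<Prod>r\<in>prime_factors (order G). ?v r)" by auto
  moreover have "(\<Prod>r\<in>prime_factors (order G). ?v r) = order G"
    using fin order_gt_0_iff_finite by (simp add: prime_factorization_nat[symmetric])
  ultimately show thesis using that by simp
qed

lemma integer_mod_group_iso_cyclic:
  assumes fin: "finite (carrier G)" and a: "a \<in> carrier G" "ord a = order G"
  shows "integer_mod_group (order G) \<cong> G"
proof (rule is_isoI)
  \<comment> \<open>This matters because \<open>integer_mod_group 0\<close> is the infinite cyclic
    group.\<close>
  have n: "order G \<noteq> 0" using fin order_gt_0_iff_finite by simp
  let ?Z = "integer_mod_group (order G)"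
  have carrier: "carrier ?Z = {0..<int (order G)}"
    using n by (simp add: carrier_integer_mod_group)
  have "inj_on (\<lambda>i::int. a [^] i) (carrier ?Z)"
  proof (rule inj_onI)
    fix i j assume ij: "i \<in> carrier ?Z" "j \<in> carrier ?Z" "a [^] i = a [^] j"
    then have "int (order G) dvd j - i" using int_pow_eq[OF a(1)] a(2) by simp
    then have "j mod int (order G) = i mod int (order G)" by (simp add: mod_eq_dvd_iff)
    then show "i = j" using ij(1,2) unfolding carrier by simp
  qed
  moreover have "(\<lambda>i::int. a [^] i) ` carrier ?Z \<subseteq> carrier G" using a(1) by auto
  moreover have "card (carrier G) = card (carrier ?Z)" unfolding carrier by (simp add: order_def)
  ultimately have bij: "bij_betw (\<lambda>i::int. a [^] i) (carrier ?Z) (carrier G)"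
    using fin by (simp add: bij_betw_def card_image card_subset_eq)
  have "a [^] ((i + j) mod int (order G)) = a [^] i \<otimes> a [^] j" for i j :: int
  proof -
    have "a [^] ((i + j) mod int (order G)) = a [^] (i + j)"
      unfolding int_pow_eq[OF a(1)] a(2) by (simp add: dvd_minus_mod)
    then show ?thesis using a(1) by (simp add: int_pow_mult)
  qed
  then have "(\<lambda>i::int. a [^] i) \<in> hom ?Z G"
    using a(1) by (intro homI) auto
  then show "(\<lambda>i::int. a [^] i) \<in> iso ?Z G"
    using bij by (rule isoI)
qed

text \<open>Exchanging \<open>x [^] i\<close> with \<open>y\<close>, or \<open>x\<close> with
  \<open>y [^] i\<close>, costs \<open>w [^] i\<close>, so both \<open>k\<close> and
  \<open>l\<close> kill \<open>w\<close>. They are exponents rather than orders because the lemma is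
  used in quotients with the orders from the whole group.\<close>

lemma commutator_eq_one_if_central_coprime:
  assumes G: "x \<in> carrier G" "y \<in> carrier G" "w \<in> carrier G" and xy: "x \<otimes> y = w \<otimes> (y \<otimes> x)"
    and wx: "w \<otimes> x = x \<otimes> w" and wy: "w \<otimes> y = y \<otimes> w"
    and coprime: "coprime (k::nat) l" and x: "x [^] k = \<one>" and y: "y [^] l = \<one>"
  shows "w = \<one>"
proof -
  have k: "x [^] i \<otimes> y = w [^] i \<otimes> (y \<otimes> x [^] i)" for i :: nat
  proof (induction i)
    case (Suc i)
    have "x [^] Suc i \<otimes> y = x [^] i \<otimes> w \<otimes> y \<otimes> x"
      using G xy by (simp add: m_assoc)
    also have "x [^] i \<otimes> w = w \<otimes> x [^] i"
      using group_commutes_pow[OF wx[symmetric] G(1,3)] .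
    also have "w \<otimes> x [^] i \<otimes> y \<otimes> x = w \<otimes> (x [^] i \<otimes> y) \<otimes> x"
      using G by (simp add: m_assoc)
    also have "\<dots> = (w \<otimes> w [^] i) \<otimes> (y \<otimes> (x [^] i \<otimes> x))"
      unfolding Suc using G by (simp add: m_assoc)
    also have "w \<otimes> w [^] i = w [^] Suc i"
      using nat_pow_Suc2[OF G(3)] by simp
    finally show ?case by simp
  qed (use G in simp)
  have l: "x \<otimes> y [^] i = w [^] i \<otimes> (y [^] i \<otimes> x)" for i :: nat
  proof (induction i)
    case (Suc i)
    have wyi: "w \<otimes> y [^] i = y [^] i \<otimes> w"
      using group_commutes_pow[OF wy[symmetric] G(2,3)] by simp
    have "x \<otimes> y [^] Suc i = x \<otimes> y [^] i \<otimes> y"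
      using G by (simp add: m_assoc)
    also have "\<dots> = w [^] i \<otimes> y [^] i \<otimes> (x \<otimes> y)"
      unfolding Suc using G by (simp add: m_assoc)
    also have "\<dots> = w [^] i \<otimes> (y [^] i \<otimes> w) \<otimes> (y \<otimes> x)"
      unfolding xy using G by (simp add: m_assoc)
    also have "\<dots> = w [^] Suc i \<otimes> (y [^] Suc i \<otimes> x)"
      unfolding wyi[symmetric] using G by (simp add: m_assoc)
    finally show ?case .
  qed (use G in simp)
  have "w [^] k = \<one>"
    using k[of k] x G by (metis l_one nat_pow_closed r_cancel_one' r_one)
  moreover have "w [^] l = \<one>"
    using l[of l] y G by (metis l_one nat_pow_closed r_cancel_one' r_one)
  ultimately have "ord w dvd k" "ord w dvd l"
    using G by (simp_all add: pow_eq_id)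
  then have "ord w = 1" using coprime by (metis coprime_common_divisor_nat)
  then show ?thesis using ord_eq_1[OF G(3)] by blast
qed

lemma lower_central_series_normal: "lower_central_series G n \<lhd> G"
proof (induction n)
  case 0
  show ?case
    by (simp add: normal_inv_iff subgroup_self)
next
  case (Suc n)
  interpret N: normal "lower_central_series G n" G by (rule Suc)
  show ?case
    unfolding lower_central_series.simps(2)
  proof (rule normal_generateI)
    show "(\<Union>h\<in>lower_central_series G n. \<Union>g\<in>carrier G. {h \<otimes> g \<otimes> inv h \<otimes> inv g}) \<subseteq> carrier G"
      using N.subset by auto
    fix z y assume "z \<in> (\<Union>h\<in>lower_central_series G n. \<Union>g\<in>carrier G. {h \<otimes> g \<otimes> inv h \<otimes> inv g})"
      and y: "y \<in> carrier G"
    then obtain h g where hg: "h \<in> lower_central_series G n" "g \<in> carrier G"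
        and z: "z = h \<otimes> g \<otimes> inv h \<otimes> inv g" by blast
    have hG: "h \<in> carrier G" using N.mem_carrier[OF hg(1)] .
    define h' g' where "h' = y \<otimes> h \<otimes> inv y" and "g' = y \<otimes> g \<otimes> inv y"
    interpret f: group_hom G G "\<lambda>x. y \<otimes> x \<otimes> inv y"
      using conjugation_hom[OF y] by unfold_locales
    have "y \<otimes> z \<otimes> inv y = h' \<otimes> g' \<otimes> inv h' \<otimes> inv g'"
      unfolding z h'_def g'_def using hG hg(2) by (simp only: f.hom_mult f.hom_inv m_closed inv_closed)
    moreover have "h' \<in> lower_central_series G n"
      unfolding h'_def using N.inv_op_closed2[OF y hg(1)] .
    moreover have "g' \<in> carrier G" unfolding g'_def using y hg(2) by simp
    ultimately show "y \<otimes> z \<otimes> inv y \<in>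
        (\<Union>h\<in>lower_central_series G n. \<Union>g\<in>carrier G. {h \<otimes> g \<otimes> inv h \<otimes> inv g})"
      by blast
  qed
qed

lemma eq_commutator_mult:
  "x \<in> carrier G \<Longrightarrow> y \<in> carrier G \<Longrightarrow> x \<otimes> y = (x \<otimes> y \<otimes> inv x \<otimes> inv y) \<otimes> (y \<otimes> x)"
  by (simp add: m_assoc inv_solve_left flip: inv_mult_group)

text \<open>The commutator descends through the whole lower central series: lying in one term makes
  it central modulo the next, where \<open>commutator_eq_one_if_central_coprime\<close> kills
  it.\<close>

lemma nilpotent_coprime_commute:
  assumes nil: "nilpotent_group G" and G: "x \<in> carrier G" "y \<in> carrier G"
    and coprime: "coprime (ord x) (ord y)"
  shows "x \<otimes> y = y \<otimes> x"
proof -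
  define w where "w = x \<otimes> y \<otimes> inv x \<otimes> inv y"
  have wG: "w \<in> carrier G" unfolding w_def using G by simp
  have xy: "x \<otimes> y = w \<otimes> (y \<otimes> x)"
    unfolding w_def using G by (rule eq_commutator_mult)
  have "w \<in> lower_central_series G n" for n
  proof (induction n)
    case 0
    show ?case using wG by simp
  next
    case (Suc n)
    let ?N = "lower_central_series G (Suc n)"
    have nN: "?N \<lhd> G" by (rule lower_central_series_normal)
    interpret N: normal ?N G by (rule nN)
    interpret Q: group "G Mod ?N" by (rule N.factorgroup_is_group)
    have cl: "?N #> a \<in> carrier (G Mod ?N)" if "a \<in> carrier G" for a
      using that by (auto simp: FactGroup_def RCOSETS_def)
    have mult: "(?N #> a) \<otimes>\<^bsub>G Mod ?N\<^esub> (?N #> b) = ?N #> (a \<otimes> b)" if "a \<in> carrier G" "b \<in> carrier G" for a b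
      using N.rcos_sum[OF that] by simp
    have comm: "(?N #> w) \<otimes>\<^bsub>G Mod ?N\<^esub> (?N #> g) = (?N #> g) \<otimes>\<^bsub>G Mod ?N\<^esub> (?N #> w)" if g: "g \<in> carrier G" for g
    proof -
      define c where "c = w \<otimes> g \<otimes> inv w \<otimes> inv g"
      have "c \<in> ?N"
        unfolding lower_central_series.simps(2) c_def using Suc g by (intro generate.incl) blast
      then have "?N #> c = ?N" using N.rcos_const[OF is_group] by blast
      moreover have "w \<otimes> g = c \<otimes> (g \<otimes> w)"
        unfolding c_def using wG g by (rule eq_commutator_mult)
      moreover have "c \<in> carrier G" unfolding c_def using wG g by simp
      ultimately have "?N #> (w \<otimes> g) = ?N #> (g \<otimes> w)"
        using coset_mult_assoc[OF N.subset, of c "g \<otimes> w"] g wG by simp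
      then show ?thesis unfolding mult[OF wG g] mult[OF g wG] .
    qed
    have "?N #> w = \<one>\<^bsub>G Mod ?N\<^esub>"
    proof (rule Q.commutator_eq_one_if_central_coprime[OF cl[OF G(1)] cl[OF G(2)] cl[OF wG] _
          comm[OF G(1)] comm[OF G(2)] coprime])
      show "(?N #> x) \<otimes>\<^bsub>G Mod ?N\<^esub> (?N #> y) =
          (?N #> w) \<otimes>\<^bsub>G Mod ?N\<^esub> ((?N #> y) \<otimes>\<^bsub>G Mod ?N\<^esub> (?N #> x))"
        unfolding mult[OF G(2,1)] mult[OF G] mult[OF wG m_closed[OF G(2,1)]] xy ..
      show "(?N #> x) [^]\<^bsub>G Mod ?N\<^esub> ord x = \<one>\<^bsub>G Mod ?N\<^esub>"
        unfolding FactGroup_pow_eq_one_iff[OF nN G(1)] pow_ord_eq_1[OF G(1)] by (rule N.one_closed)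
      show "(?N #> y) [^]\<^bsub>G Mod ?N\<^esub> ord y = \<one>\<^bsub>G Mod ?N\<^esub>"
        unfolding FactGroup_pow_eq_one_iff[OF nN G(2)] pow_ord_eq_1[OF G(2)] by (rule N.one_closed)
    qed
    then have "?N #> w = ?N" by simp
    then show ?case using rcos_self[OF wG N.subgroup_axioms] by simp
  qed
  moreover obtain n where "lower_central_series G n = {\<one>}"
    using nil unfolding nilpotent_group_def by blast
  ultimately have "w = \<one>" by blast
  then show ?thesis using xy G by simp
qed

end

section \<open>Splitting over a normal Hall subgroup\<close>

context group
begin

lemma ord_subgroup:
  assumes "subgroup H G" "h \<in> H"
  shows "group.ord (G\<lparr>carrier := H\<rparr>) h = ord h"
proof -
  interpret H: group "G\<lparr>carrier := H\<rparr>"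
    using assms(1) by (rule subgroup_imp_group)
  have hH: "h \<in> carrier (G\<lparr>carrier := H\<rparr>)" using assms(2) by simp
  have one: "\<one>\<^bsub>G\<lparr>carrier := H\<rparr>\<^esub> = \<one>" by simp
  have "h [^]\<^bsub>G\<lparr>carrier := H\<rparr>\<^esub> n = \<one>\<^bsub>G\<lparr>carrier := H\<rparr>\<^esub> \<longleftrightarrow> ord h dvd n" for n :: nat
    unfolding one nat_pow_consistent[of h n H, symmetric]
    by (rule pow_eq_id[OF subgroup.mem_carrier[OF assms]])
  then show ?thesis
    using H.ord_unique[OF hH] by blast
qed

text \<open>Elements of \<open>AutoGroup\<close> are extensional, hence the restriction of each
  conjugation to \<open>A\<close>.\<close>

lemma hom_conjugation_action:
  assumes A: "A \<lhd> G" and Q: "subgroup Q G"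
  shows "(\<lambda>q. \<lambda>k\<in>A. q \<otimes> k \<otimes> inv q) \<in> hom (G\<lparr>carrier := Q\<rparr>) (AutoGroup (G\<lparr>carrier := A\<rparr>))"
proof -
  interpret A: normal A G by (rule A)
  interpret Q: subgroup Q G by (rule Q)
  have cl: "q \<otimes> k \<otimes> inv q \<in> A" if "q \<in> carrier G" "k \<in> A" for q k
    using A.inv_op_closed2 that by blast
  have aut: "(\<lambda>k\<in>A. q \<otimes> k \<otimes> inv q) \<in> auto (G\<lparr>carrier := A\<rparr>)" if q: "q \<in> Q" for q
  proof -
    have qG: "q \<in> carrier G" using Q.mem_carrier[OF q] .
    interpret f: group_hom G G "\<lambda>x. q \<otimes> x \<otimes> inv q"
      using conjugation_hom[OF qG] by unfold_locales
    have "(\<lambda>k\<in>A. q \<otimes> k \<otimes> inv q) \<in> hom (G\<lparr>carrier := A\<rparr>) (G\<lparr>carrier := A\<rparr>)"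
    proof (rule homI)
      fix x y assume "x \<in> carrier (G\<lparr>carrier := A\<rparr>)" "y \<in> carrier (G\<lparr>carrier := A\<rparr>)"
      then have "x \<in> A" "y \<in> A" by simp_all
      then show "(\<lambda>k\<in>A. q \<otimes> k \<otimes> inv q) (x \<otimes>\<^bsub>G\<lparr>carrier := A\<rparr>\<^esub> y) =
          (\<lambda>k\<in>A. q \<otimes> k \<otimes> inv q) x \<otimes>\<^bsub>G\<lparr>carrier := A\<rparr>\<^esub> (\<lambda>k\<in>A. q \<otimes> k \<otimes> inv q) y"
        using f.hom_mult[of x y] by simp
    qed (use qG cl in simp)
    moreover have "bij_betw (\<lambda>k. q \<otimes> k \<otimes> inv q) A A"
      unfolding bij_betw_def
    proof
      show "inj_on (\<lambda>k. q \<otimes> k \<otimes> inv q) A"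
        using conjugation_iso[OF qG] inj_on_subset[OF _ A.subset] by (auto simp: iso_def bij_betw_def)
      have "a \<in> (\<lambda>k. q \<otimes> k \<otimes> inv q) ` A" if a: "a \<in> A" for a
      proof (rule image_eqI)
        show "inv q \<otimes> a \<otimes> q \<in> A" using cl[OF inv_closed[OF qG] a] qG by simp
        have "q \<otimes> (inv q \<otimes> a \<otimes> q) \<otimes> inv q = (q \<otimes> inv q) \<otimes> a \<otimes> (q \<otimes> inv q)"
          using qG A.mem_carrier[OF a] by (simp only: m_assoc m_closed inv_closed)
        then show "a = q \<otimes> (inv q \<otimes> a \<otimes> q) \<otimes> inv q"
          using qG a by simp
      qed
      then show "(\<lambda>k. q \<otimes> k \<otimes> inv q) ` A = A"
        using cl[OF qG] by (intro equalityI subsetI) (elim imageE, simp_all)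
    qed
    ultimately show ?thesis
      by (simp add: auto_def Bij_def)
  qed
  show ?thesis
  proof (rule homI)
    fix q q' assume "q \<in> carrier (G\<lparr>carrier := Q\<rparr>)" "q' \<in> carrier (G\<lparr>carrier := Q\<rparr>)"
    then have q: "q \<in> Q" "q' \<in> Q" by simp_all
    then have "(\<lambda>k\<in>A. q \<otimes> k \<otimes> inv q) \<in> Bij A" "(\<lambda>k\<in>A. q' \<otimes> k \<otimes> inv q') \<in> Bij A"
      using aut by (auto simp: auto_def)
    moreover have "q \<otimes> q' \<otimes> k \<otimes> inv (q \<otimes> q') = q \<otimes> (q' \<otimes> k \<otimes> inv q') \<otimes> inv q" if "k \<in> A" for k
      using q that by (simp add: inv_mult_group m_assoc)
    ultimately show "(\<lambda>k\<in>A. q \<otimes>\<^bsub>G\<lparr>carrier := Q\<rparr>\<^esub> q' \<otimes> k \<otimes> inv (q \<otimes>\<^bsub>G\<lparr>carrier := Q\<rparr>\<^esub> q')) =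
        (\<lambda>k\<in>A. q \<otimes> k \<otimes> inv q) \<otimes>\<^bsub>AutoGroup (G\<lparr>carrier := A\<rparr>)\<^esub> (\<lambda>k\<in>A. q' \<otimes> k \<otimes> inv q')"
      using q cl by (simp add: AutoGroup_def BijGroup_def compose_def cong: restrict_cong)
  qed (use aut in \<open>simp add: AutoGroup_def\<close>)
qed

lemma semidirect_product_iso:
  assumes A: "A \<lhd> G" and Q: "subgroup Q G" and disjoint: "A \<inter> Q = {\<one>}"
    and decomp: "\<And>x. x \<in> carrier G \<Longrightarrow> \<exists>a\<in>A. \<exists>q\<in>Q. x = a \<otimes> q"
  shows "\<exists>\<phi> \<in> hom (G\<lparr>carrier := Q\<rparr>) (AutoGroup (G\<lparr>carrier := A\<rparr>)).
    G \<cong> semidirect_product (G\<lparr>carrier := A\<rparr>) \<phi> (G\<lparr>carrier := Q\<rparr>)"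
proof -
  interpret A: normal A G by (rule A)
  interpret Q: subgroup Q G by (rule Q)
  let ?K = "G\<lparr>carrier := A\<rparr>" and ?Q = "G\<lparr>carrier := Q\<rparr>"
  define \<phi> where "\<phi> = (\<lambda>q. \<lambda>k\<in>A. q \<otimes> k \<otimes> inv q)"
  have \<phi>: "\<phi> \<in> hom ?Q (AutoGroup ?K)"
    unfolding \<phi>_def by (rule hom_conjugation_action[OF A Q])
  let ?S = "semidirect_product ?K \<phi> ?Q"
  interpret S: group ?S
    using group_semidirect_product[OF subgroup_imp_group[OF A.subgroup_axioms] subgroup_imp_group[OF Q] \<phi>] .
  interpret group_disjoint_sum G A Q
    by unfold_locales
  let ?f = "\<lambda>(k, q). k \<otimes> q"
  have "?f \<in> hom ?S G"
  proof (rule homI)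
    fix x y assume "x \<in> carrier ?S" "y \<in> carrier ?S"
    then obtain k q k' q' where xy: "x = (k, q)" "y = (k', q')" "k \<in> A" "k' \<in> A" "q \<in> Q" "q' \<in> Q"
      by (auto simp: semidirect_product_def)
    have "k \<otimes> (q \<otimes> k' \<otimes> inv q) \<otimes> (q \<otimes> q') = k \<otimes> (q \<otimes> (k' \<otimes> (inv q \<otimes> q \<otimes> q')))"
      using xy by (simp only: m_assoc A.mem_carrier Q.mem_carrier m_closed inv_closed)
    also have "\<dots> = k \<otimes> q \<otimes> (k' \<otimes> q')"
      using xy by (simp add: m_assoc)
    finally show "?f (x \<otimes>\<^bsub>?S\<^esub> y) = ?f x \<otimes> ?f y"
      unfolding xy using xy by (simp add: semidirect_product_def \<phi>_def)
  qed (auto simp: semidirect_product_def)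
  moreover have "inj_on ?f (carrier ?S)"
    using cancel disjoint by (auto simp: inj_on_def semidirect_product_def)
  moreover have "?f ` carrier ?S = carrier G"
    using decomp by (force simp: semidirect_product_def)
  ultimately have "?f \<in> iso ?S G"
    by (simp add: iso_def bij_betw_def)
  then have "G \<cong> ?S"
    using S.iso_sym is_isoI by blast
  then show ?thesis using \<phi> by blast
qed

lemma direct_product_iso:
  assumes A: "subgroup A G" and Q: "subgroup Q G" and disjoint: "A \<inter> Q = {\<one>}"
    and decomp: "\<And>x. x \<in> carrier G \<Longrightarrow> \<exists>a\<in>A. \<exists>q\<in>Q. x = a \<otimes> q"
    and comm: "\<And>a q. a \<in> A \<Longrightarrow> q \<in> Q \<Longrightarrow> a \<otimes> q = q \<otimes> a"
  shows "(G\<lparr>carrier := A\<rparr>) \<times>\<times> (G\<lparr>carrier := Q\<rparr>) \<cong> G"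
proof -
  interpret group_disjoint_sum G A Q
    using A Q is_group by (simp add: group_disjoint_sum_def)
  have gen: "subgroup_generated G H = G\<lparr>carrier := H\<rparr>" if "subgroup H G" for H
    using subgroup.carrier_subgroup_generated_subgroup[OF that]
    by (simp add: subgroup_generated_def)
  have "A <#> Q = carrier G"
    using decomp AG.subset BG.subset unfolding set_mult_def by blast
  then have "(\<lambda>(x, y). x \<otimes> y) \<in> iso (subgroup_generated G A \<times>\<times> subgroup_generated G Q) G"
    unfolding iso_group_mul_alt using disjoint comm by blast
  then show ?thesis
    unfolding gen[OF A] gen[OF Q] by (rule is_isoI)
qed

text \<open>A subgroup of \<open>Q\<close> above \<open>generate G {q}\<close> has order
  \<open>p ^ b\<close> or \<open>p ^ Suc b\<close>, so nothing fits in between.\<close>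

lemma has_cyclic_maximal_subgroup_if_ord:
  assumes fin: "finite (carrier G)" and Q: "subgroup Q G" "card Q = p ^ Suc b"
    and p: "Factorial_Ring.prime p" and q: "q \<in> Q" "ord q = p ^ b"
  shows "has_cyclic_maximal_subgroup (G\<lparr>carrier := Q\<rparr>)"
proof -
  interpret Q: subgroup Q G by (rule Q)
  define M where "M = generate G {q}"
  have qG: "q \<in> carrier G" using Q.mem_carrier[OF q(1)] .
  have M: "subgroup M G" unfolding M_def by (rule subgroup_generate_singleton[OF qG])
  have MQ: "M \<subseteq> Q" unfolding M_def using generate_subgroup_incl[OF _ Q(1)] q(1) by simp
  have cardM: "card M = p ^ b" unfolding M_def using generate_pow_card[OF qG] q(2) by simp
  have finQ: "finite Q" using finite_subset[OF Q.subset fin] .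
  have p1: "1 < p" using prime_gt_1_nat[OF p] .
  have "maximal_subgroup M (G\<lparr>carrier := Q\<rparr>)"
    unfolding maximal_subgroup_def
  proof (intro conjI allI impI)
    show "subgroup M (G\<lparr>carrier := Q\<rparr>)" by (rule subgroup_incl[OF M Q(1) MQ])
    show "M \<noteq> carrier (G\<lparr>carrier := Q\<rparr>)" using cardM Q(2) p1 by auto
    fix H assume H: "subgroup H (G\<lparr>carrier := Q\<rparr>) \<and> M \<subseteq> H"
    then have HG: "subgroup H G" and HQ: "H \<subseteq> Q"
      using incl_subgroup[OF Q(1)] subgroup.subset[of H "G\<lparr>carrier := Q\<rparr>"] by auto
    have "q \<in> M" unfolding M_def by (rule generate.incl) simp
    then have "p ^ b dvd card H"
      using ord_dvd_card_subgroup[OF HG, of q] H q(2) by auto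
    have "card H dvd p ^ Suc b"
      using group.card_subgroup_dvd_order[OF subgroup_imp_group[OF Q(1)], of H] H Q(2)
      by (simp add: order_def)
    then obtain i where i: "i \<le> Suc b" "card H = p ^ i"
      using divides_primepow_nat[OF p] by blast
    have "b \<le> i"
      using \<open>p ^ b dvd card H\<close> p1 unfolding i(2) by (rule power_dvd_imp_le)
    have finH: "finite H" using finite_subset[OF HQ finQ] .
    show "H = M \<or> H = carrier (G\<lparr>carrier := Q\<rparr>)"
    proof (cases "i = b")
      case True
      then have "M = H"
        using H cardM i(2) finH by (intro card_subset_eq) auto
      then show ?thesis by simp
    next
      case False
      then have "i = Suc b" using i(1) \<open>b \<le> i\<close> by simp
      then have "H = Q"
        using HQ i(2) Q(2) finQ by (intro card_subset_eq) auto
      then show ?thesis by simp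
    qed
  qed
  moreover have "cyclic_group (G\<lparr>carrier := Q\<rparr>\<lparr>carrier := M\<rparr>)"
    using cyclic_group_generate_singleton[OF qG] by (simp add: M_def)
  ultimately show ?thesis
    unfolding has_cyclic_maximal_subgroup_def by blast
qed

text \<open>Coprime orders make any Sylow \<open>p\<close>-subgroup \<open>Q\<close> a complement of
  \<open>A\<close> by counting. The element of order \<open>p ^ b\<close> is the
  \<open>Q\<close>-component of \<open>g\<close>: it agrees with \<open>g\<close> modulo
  \<open>A\<close>, which bounds its order from below, and it stays in \<open>F\<close>, whose order
  bounds it from above.\<close>

lemma exists_sylow_complement:
  assumes fin: "finite (carrier G)" and p: "Factorial_Ring.prime p" "\<not> p dvd m"
    and order: "order G = p ^ Suc b * m" and A: "A \<lhd> G" "card A = m"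
    and F: "subgroup F G" "card F = p ^ b * m" "A \<subseteq> F" and g: "g \<in> F" "ord g = p ^ b"
  obtains Q q where "subgroup Q G" "card Q = p ^ Suc b" "A \<inter> Q = {\<one>}"
    "\<And>x. x \<in> carrier G \<Longrightarrow> \<exists>a\<in>A. \<exists>q\<in>Q. x = a \<otimes> q" "q \<in> Q" "ord q = p ^ b"
proof -
  interpret A: normal A G by (rule A(1))
  interpret F: subgroup F G by (rule F(1))
  obtain Q where Q: "subgroup Q G" "card Q = p ^ Suc b"
    using sylow_thm[OF p(1) is_group order fin] by blast
  interpret Q: subgroup Q G by (rule Q(1))
  interpret group_disjoint_sum G A Q
    by unfold_locales
  have coprime: "coprime (p ^ i) m" for i
    using prime_imp_power_coprime[OF p] by (simp add: coprime_commute)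
  have disjoint: "A \<inter> Q = {\<one>}"
  proof -
    have "x = \<one>" if "x \<in> A" "x \<in> Q" for x
    proof -
      have "ord x dvd m" "ord x dvd p ^ Suc b"
        using ord_dvd_card_subgroup[OF A.subgroup_axioms that(1)]
          ord_dvd_card_subgroup[OF Q(1) that(2)] A(2) Q(2) by simp_all
      then have "ord x = 1" using coprime[of "Suc b"] by (metis coprime_common_divisor_nat)
      then show ?thesis using ord_eq_1[of x] that(1) by simp
    qed
    then show ?thesis by auto
  qed
  let ?f = "\<lambda>(a, q). a \<otimes> q"
  have "inj_on ?f (A \<times> Q)"
    using cancel disjoint by (auto simp: inj_on_def)
  then have "card (?f ` (A \<times> Q)) = card (carrier G)"
    using A(2) Q(2) order by (simp add: card_image card_cartesian_product order_def mult.commute)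
  moreover have "?f ` (A \<times> Q) \<subseteq> carrier G" by auto
  ultimately have image: "?f ` (A \<times> Q) = carrier G"
    using fin by (intro card_subset_eq) auto
  have decomp: "\<exists>a\<in>A. \<exists>q\<in>Q. x = a \<otimes> q" if "x \<in> carrier G" for x
    using that unfolding image[symmetric] by auto
  have gG: "g \<in> carrier G" using F.mem_carrier[OF g(1)] .
  obtain a q where aq: "a \<in> A" "q \<in> Q" "g = a \<otimes> q"
    using decomp[OF gG] by blast
  have aF: "a \<in> F" using aq(1) F(3) by blast
  have G: "a \<in> carrier G" "q \<in> carrier G" using aq by auto
  have "q = inv a \<otimes> g" using aq(3) G by (simp add: inv_solve_left)
  then have "q \<in> F" using aF g(1) by simp
  have "ord q dvd p ^ b"
  proof -
    have "ord q dvd p ^ b * m" using ord_dvd_card_subgroup[OF F(1) \<open>q \<in> F\<close>] F(2) by simp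
    moreover have "ord q dvd p ^ Suc b" using ord_dvd_card_subgroup[OF Q(1) aq(2)] Q(2) by simp
    then have "coprime (ord q) m"
      using coprime[of "Suc b"] by (metis coprime_divisors dvd_refl)
    ultimately show ?thesis by (simp add: coprime_dvd_mult_left_iff)
  qed
  moreover have "p ^ b dvd ord q"
  proof -
    have "A #> g = A #> q"
      unfolding aq(3) using G A.rcos_const[OF is_group aq(1)] A.subset
      by (simp flip: coset_mult_assoc)
    then have "A #> g [^] ord q = A #> q [^] ord q"
      using A.FactGroup_pow[OF gG, of "ord q"] A.FactGroup_pow[OF G(2), of "ord q"] by metis
    then have "A #> g [^] ord q = A"
      using G(2) A.subset by simp
    then have gA: "g [^] ord q \<in> A"
      using rcos_self[OF nat_pow_closed[OF gG] A.subgroup_axioms, of "ord q"] by simp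
    have "ord (g [^] ord q) dvd m"
      using ord_dvd_card_subgroup[OF A.subgroup_axioms gA] A(2) by simp
    moreover have "(g [^] ord q) [^] (p ^ b) = \<one>"
      using gG g(2) by (simp add: nat_pow_pow pow_eq_id)
    then have "ord (g [^] ord q) dvd p ^ b"
      using gG by (simp add: pow_eq_id)
    ultimately have "ord (g [^] ord q) = 1"
      using coprime[of b] by (metis coprime_common_divisor_nat)
    then have "g [^] ord q = \<one>"
      using ord_eq_1[OF nat_pow_closed[OF gG]] by blast
    then show ?thesis using gG g(2) by (simp add: pow_eq_id)
  qed
  ultimately have "ord q = p ^ b" by (rule dvd_antisym)
  then show thesis
    using that Q disjoint decomp aq(2) by blast
qed

end

text \<open>One complement serves both conclusions. In the nilpotent case elements of coprime order
  commute, which makes the normal factor cyclic and the semidirect product direct.\<close>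

theorem (in group) split_over_normal_hall:
  assumes fin: "finite (carrier G)" and p: "Factorial_Ring.prime p" "\<not> p dvd m"
    and order: "order G = p ^ Suc b * m" and A: "A \<lhd> G" "card A = m"
    and F: "subgroup F G" "card F = p ^ b * m" "A \<subseteq> F" and g: "g \<in> F" "ord g = p ^ b"
    and sylow: "\<And>r. Factorial_Ring.prime r \<Longrightarrow> \<exists>h\<in>A. ord h = r ^ multiplicity r m"
  obtains K Q where "Z_group (G\<lparr>carrier := K\<rparr>)" "card K = m"
    "p_group p (G\<lparr>carrier := Q\<rparr>)" "has_cyclic_maximal_subgroup (G\<lparr>carrier := Q\<rparr>)"
    "\<exists>\<phi> \<in> hom (G\<lparr>carrier := Q\<rparr>) (AutoGroup (G\<lparr>carrier := K\<rparr>)).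
      G \<cong> semidirect_product (G\<lparr>carrier := K\<rparr>) \<phi> (G\<lparr>carrier := Q\<rparr>)"
    "nilpotent_group G \<Longrightarrow> G \<cong> integer_mod_group m \<times>\<times> (G\<lparr>carrier := Q\<rparr>)"
proof -
  interpret A: normal A G by (rule A(1))
  obtain Q q where Q: "subgroup Q G" "card Q = p ^ Suc b" "A \<inter> Q = {\<one>}"
    "\<And>x. x \<in> carrier G \<Longrightarrow> \<exists>a\<in>A. \<exists>q\<in>Q. x = a \<otimes> q" "q \<in> Q" "ord q = p ^ b"
    using exists_sylow_complement[OF fin p order A F g] by blast
  interpret Q: subgroup Q G by (rule Q(1))
  let ?K = "G\<lparr>carrier := A\<rparr>" and ?Q = "G\<lparr>carrier := Q\<rparr>"
  interpret K: group ?K by (rule subgroup_imp_group[OF A.subgroup_axioms])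
  have orderK: "order ?K = m" using A(2) by (simp add: order_def)
  have finK: "finite (carrier ?K)" using finite_subset[OF A.subset fin] by simp
  have sylowK: "\<exists>h\<in>carrier ?K. K.ord h = r ^ multiplicity r (order ?K)"
    if r: "Factorial_Ring.prime r" for r
    using sylow[OF r] ord_subgroup[OF A.subgroup_axioms] unfolding orderK by auto
  have "p_group p ?Q"
    unfolding p_group_def order_def
    using subgroup_imp_group[OF Q(1)] p(1) Q(2) by (intro conjI exI[of _ "Suc b"]) simp_all
  moreover have "G \<cong> integer_mod_group m \<times>\<times> ?Q" if nil: "nilpotent_group G"
  proof -
    have "x \<otimes>\<^bsub>?K\<^esub> y = y \<otimes>\<^bsub>?K\<^esub> x"
      if "x \<in> carrier ?K" "y \<in> carrier ?K" "coprime (K.ord x) (K.ord y)" for x y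
      using nilpotent_coprime_commute[OF nil, of x y] that ord_subgroup[OF A.subgroup_axioms] by simp
    then obtain a where a: "a \<in> carrier ?K" "K.ord a = order ?K"
      using K.cyclic_if_sylow_cyclic_and_coprime_commute[OF finK sylowK] by blast
    have Zm: "integer_mod_group m \<cong> ?K"
      using K.integer_mod_group_iso_cyclic[OF finK a] unfolding orderK .
    have "?K \<times>\<times> ?Q \<cong> G"
    proof (rule direct_product_iso[OF A.subgroup_axioms Q(1,3,4)])
      fix x y assume xy: "x \<in> A" "y \<in> Q"
      have "ord x dvd m" "ord y dvd p ^ Suc b"
        using ord_dvd_card_subgroup[OF A.subgroup_axioms xy(1)]
          ord_dvd_card_subgroup[OF Q(1) xy(2)] A(2) Q(2) by simp_all
      moreover have "coprime m (p ^ Suc b)"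
        using prime_imp_power_coprime[OF p] .
      ultimately have "coprime (ord x) (ord y)" by (rule coprime_divisors)
      then show "x \<otimes> y = y \<otimes> x"
        by (rule nilpotent_coprime_commute[OF nil A.mem_carrier[OF xy(1)] Q.mem_carrier[OF xy(2)]])
    qed
    moreover have "integer_mod_group m \<times>\<times> ?Q \<cong> ?K \<times>\<times> ?Q"
      using group.DirProd_iso_trans[OF group_integer_mod_group Zm iso_refl] .
    ultimately have "integer_mod_group m \<times>\<times> ?Q \<cong> G"
      using iso_trans by blast
    then show ?thesis
      using group.iso_sym[OF DirProd_group[OF group_integer_mod_group subgroup_imp_group[OF Q(1)]]]
      by blast
  qed
  ultimately show thesis
    using that[of A Q] K.Z_groupI[OF finK sylowK] A(2)
      has_cyclic_maximal_subgroup_if_ord[OF fin Q(1,2) p(1) Q(5,6)]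
      semidirect_product_iso[OF A(1) Q(1,3,4)]
    by blast
qed

section \<open>The multiplicative group of a skew brace of CCS type\<close>

text \<open>The \<open>r ^ k\<close>-torsion of \<open>generate G {c}\<close> is characteristic, so
  \<open>ord_M_eq_ord\<close> applies to its generator. The additive exponent is recorded because it
  later places \<open>h\<close> in the \<open>m\<close>-torsion.\<close>

lemma (in brace_action) exists_prime_power_ord_M:
  assumes c: "c \<in> carrier G" and char: "characteristic_subgroup (generate G {c}) G"
    and r: "Factorial_Ring.prime r" "2 < r" and dvd: "r ^ k dvd ord c"
  shows "\<exists>h\<in>generate G {c}. h [^] (r ^ k) = \<one> \<and> M.ord h = r ^ k"
proof -
  define h where "h = c [^] (ord c div r ^ k)"
  have hG: "h \<in> carrier G" using c by (simp add: h_def)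
  have tors: "{x \<in> generate G {c}. x [^] (r ^ k) = \<one>} = generate G {h}"
    unfolding h_def by (rule torsion_of_cyclic[OF finite_carrier c dvd])
  have charh: "characteristic_subgroup (generate G {h}) G"
    using characteristic_torsion[OF finite_carrier char cyclic_subgroup_commute[OF c], of "r ^ k"]
    unfolding tors .
  have "ord h = r ^ k"
    using card_torsion_of_cyclic[OF finite_carrier c dvd] generate_pow_card[OF hG] unfolding tors by simp
  then have "M.ord h = r ^ k"
    by (rule ord_M_eq_ord[OF r hG _ charh])
  moreover have "h \<in> generate G {h}" by (rule generate.incl) simp
  ultimately show ?thesis unfolding tors[symmetric] by blast
qed

text \<open>The brace law says exactly that each \<open>lam a\<close> is additive. Multiplicativity
  in \<open>a\<close> follows by evaluating the multiplicative product of \<open>a\<close>,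
  \<open>b\<close> and \<open>z\<close> in both bracketings.\<close>

lemma brace_actionI:
  fixes G (structure) and M
  assumes G: "group G" and M: "group M" and fin: "finite (carrier G)" and carrier: "carrier M = carrier G"
    and distrib: "\<And>a b c. \<lbrakk>a \<in> carrier G; b \<in> carrier G; c \<in> carrier G\<rbrakk>
      \<Longrightarrow> a \<otimes>\<^bsub>M\<^esub> (b \<otimes> c) = (a \<otimes>\<^bsub>M\<^esub> b \<otimes> inv a) \<otimes> (a \<otimes>\<^bsub>M\<^esub> c)"
  shows "brace_action G M (\<lambda>a b. inv a \<otimes> (a \<otimes>\<^bsub>M\<^esub> b))"
proof -
  interpret G: group G by (rule G)
  interpret M: group M by (rule M)
  define lam where "lam = (\<lambda>a b. inv a \<otimes> (a \<otimes>\<^bsub>M\<^esub> b))"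
  have closed: "a \<otimes>\<^bsub>M\<^esub> b \<in> carrier G" if "a \<in> carrier G" "b \<in> carrier G" for a b
    using M.m_closed[of a b] that carrier by simp
  have lam_closed: "lam a b \<in> carrier G" if "a \<in> carrier G" "b \<in> carrier G" for a b
    unfolding lam_def using that closed by simp
  have mult: "a \<otimes>\<^bsub>M\<^esub> b = a \<otimes> lam a b" if "a \<in> carrier G" "b \<in> carrier G" for a b
    unfolding lam_def using that closed by (simp flip: G.m_assoc)
  have hom: "lam a \<in> hom G G" if a: "a \<in> carrier G" for a
  proof (rule homI)
    fix b c assume bc: "b \<in> carrier G" "c \<in> carrier G"
    show "lam a (b \<otimes> c) = lam a b \<otimes> lam a c"
      unfolding lam_def distrib[OF a bc] using a bc closed by (simp add: G.m_assoc)
  qed (use lam_closed[OF a] in simp)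
  have iso: "lam a \<in> iso G G" if a: "a \<in> carrier G" for a
  proof -
    have "inj_on (lam a) (carrier G)"
    proof (rule inj_onI)
      fix b c assume bc: "b \<in> carrier G" "c \<in> carrier G" "lam a b = lam a c"
      then have "a \<otimes>\<^bsub>M\<^esub> b = a \<otimes>\<^bsub>M\<^esub> c" using mult a by simp
      then show "b = c" using M.l_cancel[of a b c] a bc carrier by simp
    qed
    moreover have "lam a ` carrier G \<subseteq> carrier G" using lam_closed[OF a] by blast
    ultimately have "bij_betw (lam a) (carrier G) (carrier G)"
      using endo_inj_surj[OF fin] by (simp add: bij_betw_def)
    then show ?thesis using hom[OF a] by (simp add: iso_def)
  qed
  have lam_mult: "lam (a \<otimes>\<^bsub>M\<^esub> b) z = lam a (lam b z)" if abz: "a \<in> carrier G" "b \<in> carrier G" "z \<in> carrier G" for a b z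
  proof -
    interpret lam: group_hom G G "lam a"
      using hom[OF abz(1)] by unfold_locales
    have "lam a b \<otimes> lam a (lam b z) = lam a (b \<otimes>\<^bsub>M\<^esub> z)"
      using mult[OF abz(2,3)] abz lam_closed by simp
    then have "a \<otimes> (lam a b \<otimes> lam a (lam b z)) = a \<otimes>\<^bsub>M\<^esub> (b \<otimes>\<^bsub>M\<^esub> z)"
      using mult[OF abz(1) closed[OF abz(2,3)]] by simp
    then have "(a \<otimes>\<^bsub>M\<^esub> b) \<otimes> lam a (lam b z) = (a \<otimes>\<^bsub>M\<^esub> b) \<otimes>\<^bsub>M\<^esub> z"
      using mult[OF abz(1,2)] abz lam_closed M.m_assoc[of a b z] carrier by (simp add: G.m_assoc)
    also have "\<dots> = (a \<otimes>\<^bsub>M\<^esub> b) \<otimes> lam (a \<otimes>\<^bsub>M\<^esub> b) z"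
      using mult closed abz by simp
    finally show ?thesis
      using abz closed lam_closed by simp
  qed
  have "brace_action G M lam"
    by (intro brace_action.intro brace_action_axioms.intro) (fact G M fin carrier mult iso lam_mult)+
  then show ?thesis unfolding lam_def .
qed

text \<open>\<open>B\<close> carries the extra fields of a ring record, while \<open>K\<close> and
  \<open>Q\<close> are wanted in type \<open>'a monoid\<close>; carrier updates of this truncation
  have that type.\<close>

definition multiplicative_monoid :: "('a, 'b) monoid_scheme \<Rightarrow> 'a monoid"
  where "multiplicative_monoid G = \<lparr>carrier = carrier G, monoid.mult = monoid.mult G, one = one G\<rparr>"

lemma multiplicative_monoid_simps [simp]:
  "carrier (multiplicative_monoid G) = carrier G"
  "monoid.mult (multiplicative_monoid G) = monoid.mult G"
  "one (multiplicative_monoid G) = one G"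
  unfolding multiplicative_monoid_def by simp_all

lemma m_inv_multiplicative_monoid [simp]: "m_inv (multiplicative_monoid G) = m_inv G"
  unfolding m_inv_def multiplicative_monoid_simps ..

lemma group_multiplicative_monoid [simp]: "group (multiplicative_monoid G) \<longleftrightarrow> group G"
  unfolding Group.group_def group_axioms_def Group.monoid_def Units_def multiplicative_monoid_simps ..

lemma generate_multiplicative_monoid [simp]: "generate (multiplicative_monoid G) S = generate G S"
proof (intro equalityI subsetI)
  show "x \<in> generate G S" if "x \<in> generate (multiplicative_monoid G) S" for x
    using that by induction (auto intro: generate.intros)
  show "x \<in> generate (multiplicative_monoid G) S" if "x \<in> generate G S" for x
    using that
  proof induction
    case one
    show ?case using generate.one[of "multiplicative_monoid G" S] by simp
  next
    case (inv h)
    then show ?case using generate.inv[of h S "multiplicative_monoid G"] by simp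
  next
    case (eng h1 h2)
    then show ?case using generate.eng[of h1 "multiplicative_monoid G" S h2] by simp
  qed (rule generate.incl)
qed

lemma nilpotent_group_multiplicative_monoid [simp]:
  "nilpotent_group (multiplicative_monoid G) \<longleftrightarrow> nilpotent_group G"
proof -
  have "lower_central_series (multiplicative_monoid G) n = lower_central_series G n" for n
    by (induction n) simp_all
  then show ?thesis by (simp add: nilpotent_group_def)
qed

lemma iso_multiplicative_monoid: "multiplicative_monoid G \<cong> H \<longleftrightarrow> G \<cong> H"
  unfolding is_iso_def iso_def hom_def multiplicative_monoid_simps ..

theorem theorem1p3:
  fixes B :: "('a, 'b) ring_scheme"
    and p \<alpha> m t :: nat
    and q e :: "nat \<Rightarrow> nat"
  assumes brace: "skew_brace B"
    and ccs: "CCS_group (add_monoid B)"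
    and p: "Factorial_Ring.prime p" "2 < p"
    and primes: "\<And>i. i \<in> {2..t} \<Longrightarrow> Factorial_Ring.prime (q i) \<and> p < q i"
    and increasing: "strict_mono_on {2..t} q"
    and \<alpha>: "\<alpha> > 0"
    and m: "m = (\<Prod>i\<in>{2..t}. q i ^ e i)"
    and card_B: "card (carrier B) = p ^ \<alpha> * m"
    and non_nilpotent: "\<not> nilpotent_group (add_monoid B)"
    and non_perfect: "\<not> perfect_group (add_monoid B)"
  shows
    "(nilpotent_group B \<and>
       (\<exists>Q :: 'a monoid. p_group p Q \<and> has_cyclic_maximal_subgroup Q \<and>
          B \<cong> integer_mod_group m \<times>\<times> Q))
     \<or>
     (\<not> nilpotent_group B \<and>
       (\<exists>(K :: 'a monoid) (Q :: 'a monoid) \<phi>.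
          Z_group K \<and> card (carrier K) = m \<and>
          p_group p Q \<and> has_cyclic_maximal_subgroup Q \<and>
          \<phi> \<in> hom Q (AutoGroup K) \<and>
          B \<cong> semidirect_product K \<phi> Q))"
proof -
  define G where "G = add_monoid B"
  define M where "M = multiplicative_monoid B"
  have carrierG: "carrier G = carrier B" by (simp add: G_def)
  have group: "group G" "group M"
    using skew_brace.additive_group[OF brace] skew_brace.multiplicative_group[OF brace]
    by (simp_all add: G_def M_def)
  interpret G: ccs_nonnilpotent_nonperfect G
    unfolding ccs_nonnilpotent_nonperfect_def ccs_nonnilpotent_nonperfect_axioms_def
    using group(1) ccs non_nilpotent non_perfect by (simp add: G_def)
  have orderG: "order G = p ^ \<alpha> * m"
    using card_B by (simp add: order_def carrierG)
  have prime_m: "p < l" if l: "Factorial_Ring.prime l" "l dvd m" for l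
  proof -
    obtain i where i: "i \<in> {2..t}" "l dvd q i ^ e i"
      using l by (auto simp: m prime_dvd_prod_iff)
    then have "l dvd q i" using l(1) prime_dvd_power by blast
    then have "l = q i" using primes_dvd_imp_eq[OF l(1)] primes[OF i(1)] by blast
    then show ?thesis using primes[OF i(1)] by simp
  qed
  \<comment> \<open>With \<alpha> positive, \<open>p ^ b\<close> is the \<open>p\<close>-part of the
    order of a subgroup of index \<open>p\<close>.\<close>
  define b where "b = \<alpha> - 1"
  have b: "\<alpha> = Suc b" using \<alpha> by (simp add: b_def)
  have "p dvd order G" unfolding orderG b by simp
  moreover have "p \<le> l" if l: "Factorial_Ring.prime l" "l dvd order G" for l
  proof -
    have "l dvd p ^ \<alpha> \<or> l dvd m"
      using l unfolding orderG by (simp add: prime_dvd_mult_iff)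
    then show ?thesis
    proof
      assume "l dvd p ^ \<alpha>"
      then have "l dvd p" by (rule prime_dvd_power[OF l(1)])
      then show ?thesis using primes_dvd_imp_eq[OF l(1) p(1)] by simp
    qed (use prime_m[OF l(1)] in simp)
  qed
  ultimately obtain c where c: "c \<in> carrier G" "characteristic_subgroup (generate G {c}) G"
      and index: "order G = p * G.ord c"
    using G.exists_characteristic_cyclic_index[OF p(1)] by blast
  have n: "G.ord c = p ^ b * m"
    using index p(2) unfolding orderG b by simp
  have "brace_action G M (\<lambda>x y. inv\<^bsub>G\<^esub> x \<otimes>\<^bsub>G\<^esub> (x \<otimes>\<^bsub>M\<^esub> y))"
  proof (rule brace_actionI[OF group G.fin])
    show "carrier M = carrier G" by (simp add: M_def G_def)
    fix x y z assume "x \<in> carrier G" "y \<in> carrier G" "z \<in> carrier G"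
    then show "x \<otimes>\<^bsub>M\<^esub> (y \<otimes>\<^bsub>G\<^esub> z) = (x \<otimes>\<^bsub>M\<^esub> y \<otimes>\<^bsub>G\<^esub> inv\<^bsub>G\<^esub> x) \<otimes>\<^bsub>G\<^esub> (x \<otimes>\<^bsub>M\<^esub> z)"
      using skew_brace.brace_distrib[OF brace, of x y z]
      by (simp add: G_def M_def a_minus_def a_inv_def)
  qed
  then interpret brace_action G M "\<lambda>x y. inv\<^bsub>G\<^esub> x \<otimes>\<^bsub>G\<^esub> (x \<otimes>\<^bsub>M\<^esub> y)" .
  define A where "A = {y \<in> generate G {c}. y [^]\<^bsub>G\<^esub> m = \<one>\<^bsub>G\<^esub>}"
  have A: "A \<lhd> M" "card A = m"
    unfolding A_def using torsion_normal_M[OF c p(1) index n prime_m]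
      G.card_torsion_of_cyclic[OF G.fin c(1), of m] n by simp_all
  have F: "subgroup (generate G {c}) M" "card (generate G {c}) = p ^ b * m" "A \<subseteq> generate G {c}"
    using characteristic_imp_subgroup_M[OF c(2)] G.generate_pow_card[OF c(1)] n by (auto simp: A_def)
  \<comment> \<open>For \<open>b = 0\<close> this is the identity, and \<open>Q\<close> then has
    order \<open>p\<close> with trivial maximal subgroup.\<close>
  obtain g where g: "g \<in> generate G {c}" "M.ord g = p ^ b"
    using exists_prime_power_ord_M[OF c p, of b] n by auto
  have sylow: "\<exists>h\<in>A. M.ord h = r ^ multiplicity r m" if r: "Factorial_Ring.prime r" for r
  proof (cases "r dvd m")
    case True
    have "r ^ multiplicity r m dvd m" by (rule multiplicity_dvd)
    then have "r ^ multiplicity r m dvd G.ord c" unfolding n by simp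
    moreover have "2 < r" using prime_m[OF r True] p(2) by simp
    ultimately obtain h where h: "h \<in> generate G {c}" "h [^]\<^bsub>G\<^esub> (r ^ multiplicity r m) = \<one>\<^bsub>G\<^esub>"
        "M.ord h = r ^ multiplicity r m"
      using exists_prime_power_ord_M[OF c r] by blast
    have hG: "h \<in> carrier G" using h(1) G.generate_in_carrier[of "{c}"] c(1) by blast
    have "h [^]\<^bsub>G\<^esub> m = \<one>\<^bsub>G\<^esub>"
      using h(2) \<open>r ^ multiplicity r m dvd m\<close> G.pow_eq_id[OF hG] dvd_trans by blast
    then show ?thesis using h A_def by blast
  next
    \<comment> \<open>Here the multiplicity is 0, so an element of order 1 is asked for.\<close>
    case False
    have "\<one>\<^bsub>M\<^esub> \<in> A" using A(1) normal_imp_subgroup subgroup.one_closed by blast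
    moreover have "M.ord \<one>\<^bsub>M\<^esub> = r ^ multiplicity r m"
      using False by (simp add: not_dvd_imp_multiplicity_0)
    ultimately show ?thesis by blast
  qed
  have "finite (carrier M)" "order M = p ^ Suc b * m"
    using G.fin orderG b by (simp_all add: M_def order_def carrierG)
  moreover have "\<not> p dvd m" using prime_m[OF p(1)] by blast
  ultimately obtain K Q where KQ: "Z_group (M\<lparr>carrier := K\<rparr>)" "card K = m"
    "p_group p (M\<lparr>carrier := Q\<rparr>)" "has_cyclic_maximal_subgroup (M\<lparr>carrier := Q\<rparr>)"
    "\<exists>\<phi> \<in> hom (M\<lparr>carrier := Q\<rparr>) (AutoGroup (M\<lparr>carrier := K\<rparr>)).
      M \<cong> semidirect_product (M\<lparr>carrier := K\<rparr>) \<phi> (M\<lparr>carrier := Q\<rparr>)"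
    "nilpotent_group M \<Longrightarrow> M \<cong> integer_mod_group m \<times>\<times> (M\<lparr>carrier := Q\<rparr>)"
    using M.split_over_normal_hall[OF _ p(1) _ _ A F g sylow] by blast
  show ?thesis
  proof (cases "nilpotent_group B")
    case True
    then show ?thesis
      using KQ(3,4,6) unfolding M_def iso_multiplicative_monoid by auto
  next
    case False
    have "card (carrier (M\<lparr>carrier := K\<rparr>)) = m" using KQ(2) by simp
    moreover from KQ(5) obtain \<phi> where "\<phi> \<in> hom (M\<lparr>carrier := Q\<rparr>) (AutoGroup (M\<lparr>carrier := K\<rparr>))"
      "B \<cong> semidirect_product (M\<lparr>carrier := K\<rparr>) \<phi> (M\<lparr>carrier := Q\<rparr>)"
      unfolding M_def iso_multiplicative_monoid by blast
    ultimately show ?thesis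
      using False KQ(1,3,4) by blast
  qed
qed

end
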